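(* Let $A\in\mathbb{H}_d[z,z^{-1}]$ satisfy $A^\dagger=-A$ and be invertible on the unit circle, with symmetric partial indices $\mathcal{K}=\{\kappa_1\ge\dots\ge\kappa_d\}$. Then there exists a factorization $A=A_+D_4A_+^\dagger$ with $A_+\in\mathbb{H}_d[z]$ invertible for all $|z|\le1$ and $$D_4=-\sum_{m\in\mathcal{M}_+}\big(z^{\kappa_m}|\bar m\rangle\langle m|-z^{-\kappa_m}|m\rangle\langle\bar m|\big)\mathbf{1}_{\mathbb{H}}+\sum_{m\in\mathcal{M}_0}|m\rangle\langle m|\,\mathbf{k}.$$
   Context: Quaternions are realized as real combinations of $\mathbf{1}_{\mathbb{H}}=I_2$, $\mathbf{i}=i\sigma_x$, $\mathbf{j}=i\sigma_y$, $\mathbf{k}=i\sigma_z$; so $\mathbb{H}_d\subset\mathbb{C}_{2d}$ is the set of $Q$ with $(I_d\otimes\sigma_y)\overline{Q}(I_d\otimes\sigma_y)=Q$, and $|m\rangle\langle m'|\mathbf{1}_{\mathbb{H}}$, $|m\rangle\langle m|\mathbf{k}$ denote the $2\times2$ blocks $I_2$, $i\sigma_z$ placed at block position $(m,m')$, $(m,m)$. $\mathbb{H}_d[z,z^{-1}]$ denotes Laurent polynomials $\sum_{r}a_rz^r$ with $a_r\in\mathbb{H}_d$; $\mathbb{H}_d[z]$ those with only nonnegative powers; $A^\dagger(z):=\sum_r a_r^\dagger z^{-r}$. A standard WH factorization of a complex matrix Laurent polynomial invertible on $|z|=1$ is $A=A_+DA_-$, $A_+$ polynomial in $z$ invertible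 for $|z|\le1$, $A_-$ polynomial in $z^{-1}$ invertible for $|z^{-1}|\le1$, $D=\mathrm{diag}(z^{\kappa_1},\dots)$ with nonincreasing integer partial indices, which are unique. For $A\in\mathbb{H}_d[z,z^{-1}]$ viewed in $\mathbb{C}_{2d}[z,z^{-1}]$ the $2d$ standard partial indices occur in equal pairs; the symmetric partial indices $\mathcal{K}$ keep one of each pair. $\mathcal{M}_\pm=\{m:\pm\kappa_m>0\}$, $\mathcal{M}_0=\{m:\kappa_m=0\}$, $\bar m=d+1-m$. *)

theory Defs
  imports Complex_Main "Jordan_Normal_Form.Determinant"
begin

text \<open>Matrices of size 2d x 2d over the complex numbers (0-based indices); the quaternionic
block m (0-based, m < d) occupies rows/columns 2m and 2m+1.
A matrix Laurent polynomial is a coefficient function int => complex mat with finite support.\<close>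

definition lpoly :: "nat \<Rightarrow> (int \<Rightarrow> complex mat) \<Rightarrow> bool" where
  "lpoly d c \<longleftrightarrow> (\<forall>r. c r \<in> carrier_mat (2*d) (2*d)) \<and> finite {r. c r \<noteq> 0\<^sub>m (2*d) (2*d)}"

definition evalL :: "nat \<Rightarrow> (int \<Rightarrow> complex mat) \<Rightarrow> complex \<Rightarrow> complex mat" where
  "evalL d c z = mat (2*d) (2*d)
     (\<lambda>(i,j). \<Sum>r\<in>{r. c r \<noteq> 0\<^sub>m (2*d) (2*d)}. z powi r * (c r $$ (i,j)))"

definition cadj :: "complex mat \<Rightarrow> complex mat" where
  "cadj Q = mat (dim_col Q) (dim_row Q) (\<lambda>(i,j). cnj (Q $$ (j,i)))"

text \<open>A^dagger(z) = sum_r a_r^dagger z^(-r)\<close>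
definition ldag :: "(int \<Rightarrow> complex mat) \<Rightarrow> (int \<Rightarrow> complex mat)" where
  "ldag c = (\<lambda>r. cadj (c (-r)))"

text \<open>I_d tensor sigma_y, sigma_y = [[0,-i],[i,0]]\<close>
definition sigy_blk :: "nat \<Rightarrow> complex mat" where
  "sigy_blk d = mat (2*d) (2*d) (\<lambda>(i,j).
     if i div 2 = j div 2 then
       (if i mod 2 = 0 \<and> j mod 2 = 1 then - \<i> else if i mod 2 = 1 \<and> j mod 2 = 0 then \<i> else 0)
     else 0)"

definition quat_mat :: "nat \<Rightarrow> complex mat \<Rightarrow> bool" where
  "quat_mat d Q \<longleftrightarrow> Q \<in> carrier_mat (2*d) (2*d) \<and>
     sigy_blk d * map_mat cnj Q * sigy_blk d = Q"

definition quat_lpoly :: "nat \<Rightarrow> (int \<Rightarrow> complex mat) \<Rightarrow> bool" where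
  "quat_lpoly d c \<longleftrightarrow> lpoly d c \<and> (\<forall>r. quat_mat d (c r))"

definition diag_powi :: "nat \<Rightarrow> int list \<Rightarrow> complex \<Rightarrow> complex mat" where
  "diag_powi n ks z = mat n n (\<lambda>(i,j). if i = j then z powi (ks ! i) else 0)"

text \<open>Standard Wiener-Hopf factorization A = A_+ D A_- with partial indices ks (list of length n = 2d,
nonincreasing). Equality of Laurent polynomials is expressed as equality of evaluations at all z \<noteq> 0.\<close>
definition std_WH :: "nat \<Rightarrow> (int \<Rightarrow> complex mat) \<Rightarrow> (int \<Rightarrow> complex mat) \<Rightarrow> int list
    \<Rightarrow> (int \<Rightarrow> complex mat) \<Rightarrow> bool" where
  "std_WH d A Ap ks Am \<longleftrightarrow>
     lpoly d Ap \<and> lpoly d Am \<and> length ks = 2*d \<and> sorted_wrt (\<ge>) ks \<and>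
     (\<forall>r<0. Ap r = 0\<^sub>m (2*d) (2*d)) \<and> (\<forall>z. cmod z \<le> 1 \<longrightarrow> det (evalL d Ap z) \<noteq> 0) \<and>
     (\<forall>r>0. Am r = 0\<^sub>m (2*d) (2*d)) \<and> (\<forall>z. z \<noteq> 0 \<and> cmod z \<ge> 1 \<longrightarrow> det (evalL d Am z) \<noteq> 0) \<and>
     det (Am 0) \<noteq> 0 \<and>
     (\<forall>z. z \<noteq> 0 \<longrightarrow> evalL d A z = evalL d Ap z * diag_powi (2*d) ks z * evalL d Am z)"

text \<open>Standard partial indices of A (unique when they exist) are ks.\<close>
definition std_partial_indices :: "nat \<Rightarrow> (int \<Rightarrow> complex mat) \<Rightarrow> int list \<Rightarrow> bool" where
  "std_partial_indices d A ks \<longleftrightarrow> (\<exists>Ap Am. std_WH d A Ap ks Am)"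

definition sym_partial_indices :: "nat \<Rightarrow> (int \<Rightarrow> complex mat) \<Rightarrow> int list \<Rightarrow> bool" where
  "sym_partial_indices d A K \<longleftrightarrow> length K = d \<and> sorted_wrt (\<ge>) K \<and>
     std_partial_indices d A (map (\<lambda>i. K ! (i div 2)) [0..<2*d])"

definition blk_entry :: "complex mat \<Rightarrow> nat \<Rightarrow> nat \<Rightarrow> nat \<Rightarrow> nat \<Rightarrow> complex" where
  "blk_entry B m m' i j = (if i div 2 = m \<and> j div 2 = m' then B $$ (i mod 2, j mod 2) else 0)"

definition qk :: "complex mat" where  (* k = i sigma_z *)
  "qk = mat 2 2 (\<lambda>(i,j). if i = j then (if i = 0 then \<i> else - \<i>) else 0)"

text \<open>D_4 evaluated at z. With 0-based m < d, bar m = d - 1 - m (= d+1-m in 1-based indexing).\<close>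
definition D4 :: "nat \<Rightarrow> int list \<Rightarrow> complex \<Rightarrow> complex mat" where
  "D4 d K z = mat (2*d) (2*d) (\<lambda>(i,j).
     - (\<Sum>m\<in>{m. m < d \<and> K ! m > 0}.
          z powi (K ! m) * blk_entry (1\<^sub>m 2) (d - 1 - m) m i j
          - z powi (- (K ! m)) * blk_entry (1\<^sub>m 2) m (d - 1 - m) i j)
     + (\<Sum>m\<in>{m. m < d \<and> K ! m = 0}. blk_entry qk m m i j))"

end

theory Submission
  imports Defs "HOL-Computational_Algebra.Fundamental_Theorem_Algebra"
    "Jordan_Normal_Form.Char_Poly"
begin

text \<open>Everything is done pointwise on the unit circle, where \<open>z\<inverse>\<close> is the conjugate of \<open>z\<close>. A rational
  function without poles in the closed disc that equals \<open>z\<^sup>n\<close> times one without poles outside is a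
  polynomial of degree at most \<open>n\<close>; this replaces Liouville's theorem.

  Start from \<open>A = P D N\<close>. Comparing with \<open>A = \<tau>(P) D \<tau>(N)\<close> for the quaternionic conjugation \<open>\<tau>\<close>, a Hilbert 90
  argument makes \<open>P\<close> quaternionic. Then \<open>B = P\<inverse> A P\<^sup>-\<^sup>\<dagger>\<close> is skew and its \<open>(i,j)\<close> entry is a Laurent
  polynomial with powers from \<open>-e\<^sub>j\<close> to \<open>e\<^sub>i\<close>. A nonzero term of the Leibniz formula for \<open>det B\<close>, together
  with the degree of \<open>det A\<close>, pairs the indices off as \<open>\<kappa>, -\<kappa>\<close>.

  Arranging the exponents as \<open>e = -\<kappa>\<close>, the core \<open>B\<close> vanishes on the blocks with \<open>\<kappa>\<^sub>i + \<kappa>\<^sub>j > 0\<close> and is constant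
  where \<open>\<kappa>\<^sub>i + \<kappa>\<^sub>j = 0\<close>. One explicit block triangular congruence \<open>V\<close> then takes \<open>D\<^sub>4\<close> to \<open>B\<close>, apart from the
  block \<open>\<kappa> = 0\<close>, where a constant skew-Hermitian quaternionic form is reduced to \<open>k\<close> times the identity by
  Lagrange's diagonalization.\<close>

subsection \<open>Rational functions on the closed unit disc\<close>

text \<open>Conjugation is not holomorphic, but \<open>z -> cnj (f (cnj z))\<close> sends a rational
  function without poles in the disc to another one. Hence every minus factor is stored as a
  function \<open>N\<close> whose value \<open>N (cnj z)\<close> is the factor at \<open>z\<close>
  on the circle: both factors are then regular on the same closed disc. Inverses lead out of the
  polynomials, so comparisons take place among rational functions, and each comparison ends by
  recovering polynomials.

  The difficulty is that one factor has to respect two symmetries at once, the quaternionic and the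
  adjoint one. Once the left factor is quaternionic, the core inherits both, because forming it is
  compatible with \<open>qtau\<close> and with \<open>cadj\<close>. The minus factor then enters
  only through a bound on the powers of \<open>z\<close> in the core from above, which skewness
  reflects into a bound from below.\<close>

lemma infinite_unit_circle: "infinite {z :: complex. cmod z = 1}"
proof -
  have "inj_on (\<lambda>t. Complex t (sqrt (1 - t\<^sup>2))) {0..1}"
    by (rule inj_onI) simp
  moreover have "infinite {0..1 :: real}" by (simp add: infinite_Icc)
  ultimately have "infinite ((\<lambda>t. Complex t (sqrt (1 - t\<^sup>2))) ` {0..1})"
    using finite_imageD by blast
  moreover have "(\<lambda>t. Complex t (sqrt (1 - t\<^sup>2))) ` {0..1} \<subseteq> {z. cmod z = 1}"
    by (auto simp: cmod_def power_le_one)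
  ultimately show ?thesis using finite_subset by blast
qed

lemma poly_eq_on_circle:
  fixes p q :: "complex poly"
  assumes "\<And>z. cmod z = 1 \<Longrightarrow> poly p z = poly q z"
  shows "p = q"
proof (rule ccontr)
  assume "p \<noteq> q"
  then have "finite {z. poly (p - q) z = 0}"
    by (intro poly_roots_finite) simp
  moreover have "{z. cmod z = 1} \<subseteq> {z. poly (p - q) z = 0}"
    using assms by auto
  ultimately show False
    using infinite_unit_circle finite_subset by blast
qed

text \<open>A root of \<open>q\<close> is not a root of \<open>t\<close>, hence it is one of
  \<open>p\<close>. Cancelling the common linear factor lowers the degree of \<open>q\<close>, until
  only a unit is left.\<close>

lemma coprime_poly_dvd:
  fixes p q t :: "complex poly"
  assumes "q \<noteq> 0" "q dvd p * t" "\<And>z. poly q z = 0 \<Longrightarrow> poly t z \<noteq> 0"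
  shows "q dvd p"
  using assms
proof (induction "degree q" arbitrary: p q)
  case 0
  then have "is_unit q"
    by (simp add: is_unit_iff_degree)
  then show ?case by (rule unit_imp_dvd)
next
  case (Suc k)
  then have "\<not> constant (poly q)"
    by (metis constant_degree nat.distinct(1))
  then obtain z where z: "poly q z = 0"
    using fundamental_theorem_of_algebra by blast
  then obtain q' where q': "q = [:-z, 1:] * q'"
    by (auto simp: poly_eq_0_iff_dvd elim: dvdE)
  have "poly (p * t) z = 0"
    using Suc.prems(2) z by (metis dvdE mult_zero_left poly_mult)
  with z Suc.prems(3) have "poly p z = 0" by simp
  then obtain p' where p': "p = [:-z, 1:] * p'"
    by (auto simp: poly_eq_0_iff_dvd elim: dvdE)
  have "[:-z, 1:] * q' dvd [:-z, 1:] * (p' * t)"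
    using Suc.prems(2) unfolding p' q' by (simp only: mult.assoc)
  then have "q' dvd p' * t"
    by (subst (asm) dvd_mult_cancel_left) auto
  moreover have "q' \<noteq> 0" using Suc.prems(1) q' by auto
  moreover have "k = degree q'"
    using Suc.hyps(2) \<open>q' \<noteq> 0\<close> degree_mult_eq[of "[:-z, 1:]" q'] unfolding q' by simp
  moreover have "\<And>w. poly q' w = 0 \<Longrightarrow> poly t w \<noteq> 0"
    using Suc.prems(3) q' by auto
  ultimately have "q' dvd p'" using Suc.hyps(1) by blast
  then show ?case unfolding p' q' by (rule mult_dvd_mono[OF dvd_refl])
qed

text \<open>Nothing is asked of \<open>f\<close> off the closed disc. So totalized inverses such as
  \<open>mat_inv (P z)\<close> qualify, whatever they do at zeros of the determinant further
  out.\<close>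

definition disc_rational :: "(complex \<Rightarrow> complex) \<Rightarrow> bool" where
  "disc_rational f \<longleftrightarrow> (\<exists>p q. \<forall>z. cmod z \<le> 1 \<longrightarrow> poly q z \<noteq> 0 \<and> f z = poly p z / poly q z)"

lemma disc_rationalE:
  assumes "disc_rational f"
  obtains p q where "\<And>z. cmod z \<le> 1 \<Longrightarrow> poly q z \<noteq> 0"
    "\<And>z. cmod z \<le> 1 \<Longrightarrow> f z = poly p z / poly q z"
  using assms unfolding disc_rational_def by blast

lemma disc_rational_poly: "disc_rational (poly p)"
  unfolding disc_rational_def by (intro exI[of _ p] exI[of _ 1]) auto

lemma disc_rational_const [simp]: "disc_rational (\<lambda>_. c)"
  unfolding disc_rational_def by (intro exI[of _ "[:c:]"] exI[of _ 1]) auto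

lemma disc_rational_cong:
  "disc_rational f \<Longrightarrow> (\<And>z. cmod z \<le> 1 \<Longrightarrow> f z = g z) \<Longrightarrow> disc_rational g"
  unfolding disc_rational_def by metis

lemma disc_rational_add:
  assumes "disc_rational f" "disc_rational g"
  shows "disc_rational (\<lambda>z. f z + g z)"
proof -
  from assms(1) obtain p q where 1: "\<And>z. cmod z \<le> 1 \<Longrightarrow> poly q z \<noteq> 0"
    "\<And>z. cmod z \<le> 1 \<Longrightarrow> f z = poly p z / poly q z" by (rule disc_rationalE) blast
  from assms(2) obtain r s where 2: "\<And>z. cmod z \<le> 1 \<Longrightarrow> poly s z \<noteq> 0"
    "\<And>z. cmod z \<le> 1 \<Longrightarrow> g z = poly r z / poly s z" by (rule disc_rationalE) blast
  show ?thesis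
    unfolding disc_rational_def using 1 2
    by (intro exI[of _ "p * s + r * q"] exI[of _ "q * s"]) (auto simp: field_simps)
qed

lemma disc_rational_mult:
  assumes "disc_rational f" "disc_rational g"
  shows "disc_rational (\<lambda>z. f z * g z)"
proof -
  from assms(1) obtain p q where 1: "\<And>z. cmod z \<le> 1 \<Longrightarrow> poly q z \<noteq> 0"
    "\<And>z. cmod z \<le> 1 \<Longrightarrow> f z = poly p z / poly q z" by (rule disc_rationalE) blast
  from assms(2) obtain r s where 2: "\<And>z. cmod z \<le> 1 \<Longrightarrow> poly s z \<noteq> 0"
    "\<And>z. cmod z \<le> 1 \<Longrightarrow> g z = poly r z / poly s z" by (rule disc_rationalE) blast
  show ?thesis
    unfolding disc_rational_def using 1 2
    by (intro exI[of _ "p * r"] exI[of _ "q * s"]) auto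
qed

lemma disc_rational_inverse:
  assumes "disc_rational f" "\<And>z. cmod z \<le> 1 \<Longrightarrow> f z \<noteq> 0"
  shows "disc_rational (\<lambda>z. inverse (f z))"
proof -
  from assms(1) obtain p q where 1: "\<And>z. cmod z \<le> 1 \<Longrightarrow> poly q z \<noteq> 0"
    "\<And>z. cmod z \<le> 1 \<Longrightarrow> f z = poly p z / poly q z" by (rule disc_rationalE) blast
  show ?thesis
    unfolding disc_rational_def using 1 assms(2)
    by (intro exI[of _ q] exI[of _ p]) auto
qed

text \<open>Conjugating argument and value together conjugates the coefficients; the roots of the
  denominator are mirrored in the real axis and stay off the disc.\<close>

lemma disc_rational_cnj:
  assumes "disc_rational f"
  shows "disc_rational (\<lambda>z. cnj (f (cnj z)))"
proof -
  from assms(1) obtain p q where 1: "\<And>z. cmod z \<le> 1 \<Longrightarrow> poly q z \<noteq> 0"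
    "\<And>z. cmod z \<le> 1 \<Longrightarrow> f z = poly p z / poly q z" by (rule disc_rationalE) blast
  show ?thesis
    unfolding disc_rational_def using 1
    by (intro exI[of _ "map_poly cnj p"] exI[of _ "map_poly cnj q"]) auto
qed

lemma disc_rational_uminus: "disc_rational f \<Longrightarrow> disc_rational (\<lambda>z. - f z)"
  using disc_rational_mult[of "\<lambda>_. -1" f] by simp

lemma disc_rational_sum:
  "(\<And>i. i \<in> I \<Longrightarrow> disc_rational (f i)) \<Longrightarrow> disc_rational (\<lambda>z. \<Sum>i\<in>I. f i z)"
  by (induction I rule: infinite_finite_induct) (auto intro: disc_rational_add)

lemma disc_rational_prod:
  "(\<And>i. i \<in> I \<Longrightarrow> disc_rational (f i)) \<Longrightarrow> disc_rational (\<lambda>z. \<Prod>i\<in>I. f i z)"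
  by (induction I rule: infinite_finite_induct) (auto intro: disc_rational_mult)

lemma poly_reflect_cnj:
  assumes "cmod z = 1"
  shows "poly (reflect_poly p) z = z ^ degree p * poly p (cnj z)"
proof -
  have "z \<noteq> 0" using assms by auto
  moreover have "inverse z = cnj z"
    using assms complex_norm_square[of z] by (intro inverse_unique) simp
  ultimately show ?thesis
    using poly_reflect_poly_nz[of z p] by simp
qed

text \<open>On the circle \<open>g (cnj z)\<close> is \<open>g (1/z)\<close>, so a function without
  poles inside equals one without poles outside, up to growth of order \<open>n\<close> at infinity.
  With denominators cleared this becomes a divisibility between polynomials. The case
  \<open>p = 0\<close> stands apart because the zero polynomial has degree 0, which breaks the bound
  for negative \<open>n\<close>.\<close>

theorem disc_rational_liouville:
  assumes f: "disc_rational f" and g: "disc_rational g"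
    and eq: "\<And>z. cmod z = 1 \<Longrightarrow> f z = z powi n * g (cnj z)"
  shows "\<exists>p. (\<forall>z. cmod z \<le> 1 \<longrightarrow> f z = poly p z) \<and> (p = 0 \<or> int (degree p) \<le> n)"
proof -
  obtain p q where q: "\<And>z. cmod z \<le> 1 \<Longrightarrow> poly q z \<noteq> 0"
    and fp: "\<And>z. cmod z \<le> 1 \<Longrightarrow> f z = poly p z / poly q z"
    using f by (rule disc_rationalE) blast
  obtain r s where s: "\<And>z. cmod z \<le> 1 \<Longrightarrow> poly s z \<noteq> 0"
    and gr: "\<And>z. cmod z \<le> 1 \<Longrightarrow> g z = poly r z / poly s z"
    using g by (rule disc_rationalE) blast
  have s0: "coeff s 0 \<noteq> 0" using s[of 0] by (simp add: poly_0_coeff_0)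
  have q0: "q \<noteq> 0" using q[of 0] by auto
  \<comment> \<open>Natural exponents for both sides: \<open>nat (- n)\<close> and
    \<open>nat n\<close> split the sign of \<open>n\<close>, and the degrees compensate the powers
    of \<open>z\<close> hidden in the two reflected polynomials.\<close>
  define a where "a = nat (- n) + degree r"
  define b where "b = nat n + degree s"
  have ab: "int b - int a = n + int (degree s) - int (degree r)"
    unfolding a_def b_def by auto
  have key: "monom 1 a * p * reflect_poly s = monom 1 b * reflect_poly r * q"
  proof (rule poly_eq_on_circle)
    fix z :: complex assume z: "cmod z = 1"
    then have z0: "z \<noteq> 0" by auto
    have "poly p z / poly q z = z powi n * (poly r (cnj z) / poly s (cnj z))"
      using eq[OF z] fp[of z] gr[of "cnj z"] z by simp
    then have "poly p z * poly s (cnj z) = z powi n * poly r (cnj z) * poly q z"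
      using q[of z] s[of "cnj z"] z by (simp add: field_simps)
    moreover have "z ^ a * z ^ degree s * z powi n = z ^ b * z ^ degree r"
    proof -
      have "z powi (int a + int (degree s) + n) = z powi (int b + int (degree r))"
        using ab by (intro arg_cong[of _ _ "\<lambda>m. z powi m"]) linarith
      then show ?thesis using z0 by (simp add: power_int_add)
    qed
    ultimately have "z ^ a * z ^ degree s * (poly p z * poly s (cnj z))
        = z ^ b * z ^ degree r * (poly r (cnj z) * poly q z)"
      by (metis mult.assoc)
    then show "poly (monom 1 a * p * reflect_poly s) z
        = poly (monom 1 b * reflect_poly r * q) z"
      by (simp add: poly_monom poly_reflect_cnj[OF z] mult_ac)
  qed
  have "q dvd p * (monom 1 a * reflect_poly s)"
    using key by (metis dvd_triv_right mult.assoc mult.commute)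
  \<comment> \<open>Roots of \<open>q\<close> lie outside the disc, while this factor vanishes at
    most at 0 and at inverses of roots of \<open>s\<close>, all inside.\<close>
  moreover have "poly (monom 1 a * reflect_poly s) z \<noteq> 0" if z: "poly q z = 0" for z
  proof -
    have z1: "cmod z > 1" using q[of z] z by force
    then have "cmod (inverse z) \<le> 1" by (simp add: norm_inverse inverse_le_1_iff)
    then have "poly s (inverse z) \<noteq> 0" by (rule s)
    moreover have "z \<noteq> 0" using z1 by auto
    ultimately show ?thesis by (simp add: poly_monom poly_reflect_poly_nz)
  qed
  ultimately have "q dvd p" using coprime_poly_dvd[OF q0] by blast
  then obtain h where h: "p = q * h" by (elim dvdE)
  have "f z = poly h z" if "cmod z \<le> 1" for z
    using fp[OF that] q[OF that] h by simp
  moreover have "int (degree h) \<le> n" if "h \<noteq> 0"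
  proof -
    have "q * (monom 1 a * h * reflect_poly s) = q * (monom 1 b * reflect_poly r)"
      using key h by (simp add: algebra_simps)
    then have k2: "monom 1 a * h * reflect_poly s = monom 1 b * reflect_poly r"
      using q0 by simp
    have sn: "reflect_poly s \<noteq> 0" using s0 by auto
    \<comment> \<open>The nonzero constant term of \<open>s\<close> makes reflection preserve its
      degree; for \<open>r\<close> an upper bound is enough.\<close>
    have "degree (monom 1 a * h * reflect_poly s) = a + degree h + degree s"
      using that sn s0 by (simp add: degree_mult_eq degree_monom_eq degree_reflect_poly_eq)
    moreover have "degree (monom (1::complex) b * reflect_poly r) \<le> b + degree r"
      by (rule order_trans[OF degree_mult_le]) (simp add: degree_monom_eq degree_reflect_poly_le)
    ultimately show ?thesis using k2 ab by simp
  qed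
  ultimately show ?thesis by blast
qed

subsection \<open>Quaternions and skew-Hermitian forms\<close>

text \<open>\<open>Quat a b\<close> stands for the 2 x 2 matrix with rows \<open>(a, b)\<close> and
  \<open>(- cnj b, cnj a)\<close>, the shape that the condition with sigma_y enforces. The
  operations below, \<open>qcnj\<close> (the adjoint) and \<open>quat_k\<close> are those of these
  matrices.\<close>

datatype quat = Quat (qa: complex) (qb: complex)

lemma quat_eqI: "qa x = qa y \<Longrightarrow> qb x = qb y \<Longrightarrow> x = y"
  by (cases x; cases y) simp

instantiation quat :: division_ring
begin

definition "0 = Quat 0 0"
definition "1 = Quat 1 0"
definition "x + y = Quat (qa x + qa y) (qb x + qb y)"
definition "x - y = Quat (qa x - qa y) (qb x - qb y)"
definition "- x = Quat (- qa x) (- qb x)"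
definition "x * y = Quat (qa x * qa y - qb x * cnj (qb y)) (qa x * qb y + qb x * cnj (qa y))"
definition "inverse x = Quat (cnj (qa x) / (qa x * cnj (qa x) + qb x * cnj (qb x)))
  (- qb x / (qa x * cnj (qa x) + qb x * cnj (qb x)))"
definition "x div y = x * Quat (cnj (qa y) / (qa y * cnj (qa y) + qb y * cnj (qb y)))
  (- qb y / (qa y * cnj (qa y) + qb y * cnj (qb y)))"

lemma quat_sel [simp]:
  "qa 0 = 0" "qb 0 = 0" "qa 1 = 1" "qb 1 = 0"
  "qa (x + y) = qa x + qa y" "qb (x + y) = qb x + qb y"
  "qa (x - y) = qa x - qa y" "qb (x - y) = qb x - qb y"
  "qa (- x) = - qa x" "qb (- x) = - qb x"
  "qa (x * y) = qa x * qa y - qb x * cnj (qb y)"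
  "qb (x * y) = qa x * qb y + qb x * cnj (qa y)"
  by (simp_all add: zero_quat_def one_quat_def plus_quat_def minus_quat_def uminus_quat_def
      times_quat_def)

lemma quat_norm_nonzero:
  assumes "x \<noteq> (0 :: quat)"
  shows "qa x * cnj (qa x) + qb x * cnj (qb x) \<noteq> 0"
proof -
  have "qa x * cnj (qa x) + qb x * cnj (qb x) = of_real ((cmod (qa x))\<^sup>2 + (cmod (qb x))\<^sup>2)"
    by (simp only: complex_norm_square of_real_add)
  moreover have "qa x \<noteq> 0 \<or> qb x \<noteq> 0" using assms quat_eqI[of x 0] by auto
  then have "(cmod (qa x))\<^sup>2 + (cmod (qb x))\<^sup>2 \<noteq> 0"
    by (simp add: sum_power2_eq_zero_iff)
  ultimately show ?thesis by (metis of_real_eq_0_iff)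
qed

instance
proof
  fix x y z :: quat
  show "x * y * z = x * (y * z)" by (rule quat_eqI) (simp_all add: algebra_simps)
  show "(x + y) * z = x * z + y * z" by (rule quat_eqI) (simp_all add: algebra_simps)
  show "x * (y + z) = x * y + x * z" by (rule quat_eqI) (simp_all add: algebra_simps)
  show "(0 :: quat) \<noteq> 1" by (metis quat_sel(1,3) zero_neq_one)
  show "x div y = x * inverse y" by (simp add: divide_quat_def inverse_quat_def)
  show "inverse (0 :: quat) = 0" by (rule quat_eqI) (simp_all add: inverse_quat_def)
  show "inverse x * x = 1" "x * inverse x = 1" if "x \<noteq> 0"
    using quat_norm_nonzero[OF that]
    by (auto intro!: quat_eqI simp: inverse_quat_def mult.commute add_divide_distrib[symmetric])
qed (auto intro!: quat_eqI)

end

definition qcnj :: "quat \<Rightarrow> quat" where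
  "qcnj x = Quat (cnj (qa x)) (- qb x)"

definition quat_k :: quat where
  "quat_k = Quat \<i> 0"

lemma qcnj_sel [simp]: "qa (qcnj x) = cnj (qa x)" "qb (qcnj x) = - qb x"
  by (simp_all add: qcnj_def)

lemma qcnj_simps [simp]:
  "qcnj 0 = 0" "qcnj (qcnj x) = x" "qcnj (x + y) = qcnj x + qcnj y" "qcnj (x - y) = qcnj x - qcnj y"
  "qcnj (- x) = - qcnj x" "qcnj (x * y) = qcnj y * qcnj x"
  by (auto intro!: quat_eqI simp: algebra_simps)

lemma qcnj_inverse: "qcnj (inverse x) = inverse (qcnj x)"
  by (rule quat_eqI) (simp_all add: inverse_quat_def mult.commute)

lemma quat_sum_sel [simp]:
  "qa (\<Sum>i\<in>I. f i) = (\<Sum>i\<in>I. qa (f i))" "qb (\<Sum>i\<in>I. f i) = (\<Sum>i\<in>I. qb (f i))"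
  by (induction I rule: infinite_finite_induct) auto

lemma quat_k_sel [simp]: "qa quat_k = \<i>" "qb quat_k = 0"
  by (simp_all add: quat_k_def)

text \<open>The map \<open>k -> q k qcnj q\<close> rotates and scales, so it reaches every pure
  quaternion. With real first component \<open>x\<close> and second component \<open>y\<close>, the
  result has components \<open>\<i> * (x^2 - |y|^2)\<close> and \<open>- 2 * \<i> * x * y\<close>,
  to be solved for \<open>x\<close> and \<open>y\<close>.\<close>

lemma pure_quat_conj_k:
  assumes "qcnj s = - s"
  shows "\<exists>q. s = q * quat_k * qcnj q"
proof -
  have "cnj (qa s) = - qa s" using arg_cong[OF assms, of qa] by simp
  then have t: "qa s = \<i> * of_real t" if "t = Im (qa s)" for t
    using that by (simp add: complex_eq_iff)
  define t where "t = Im (qa s)"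
  define N where "N = sqrt (t\<^sup>2 + (cmod (qb s))\<^sup>2)"
  have N2: "N\<^sup>2 = t\<^sup>2 + (cmod (qb s))\<^sup>2" unfolding N_def by simp
  have Nt: "\<bar>t\<bar> \<le> N" unfolding N_def by (rule real_le_rsqrt) simp
  show ?thesis
  proof (cases "N + t = 0")
    \<comment> \<open>Here \<open>x\<close> would be 0: \<open>s\<close> is a nonpositive multiple
      of \<open>k\<close>, and a multiple of \<open>j\<close> as \<open>q\<close> provides the
      sign.\<close>
    case True
    then have "qb s = 0" using N2 by (simp add: add_eq_0_iff2)
    moreover have "of_real (sqrt (- t)) * of_real (sqrt (- t)) = - complex_of_real t"
      using True Nt by (simp flip: of_real_mult)
    ultimately show ?thesis
      using t[OF t_def] by (intro exI[of _ "Quat 0 (of_real (sqrt (- t)))"] quat_eqI) (auto simp: mult_ac)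
  next
    case False
    \<comment> \<open>\<open>N\<close> is the norm of \<open>s\<close>, hence
      \<open>x^2 + |y|^2 = N\<close>; together with \<open>x^2 - |y|^2 = t\<close> this fixes
      \<open>x\<close>, and the second component of \<open>s\<close> then fixes
      \<open>y\<close>.\<close>
    define x where "x = sqrt ((N + t) / 2)"
    define y where "y = \<i> * qb s / (2 * of_real x)"
    have x2: "x\<^sup>2 = (N + t) / 2" using Nt unfolding x_def by simp
    have x: "x \<noteq> 0" using False x2 by auto
    have "(cmod y)\<^sup>2 = (cmod (qb s))\<^sup>2 / (4 * x\<^sup>2)"
      by (simp add: y_def norm_mult norm_divide power_divide power_mult_distrib)
    also have "4 * x\<^sup>2 = 2 * (N + t)" using x2 by simp
    also have "(cmod (qb s))\<^sup>2 / (2 * (N + t)) = (N\<^sup>2 - t\<^sup>2) / (2 * (N + t))" by (simp add: N2)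
    also have "N\<^sup>2 - t\<^sup>2 = (N - t) * (N + t)" by (simp add: power2_eq_square algebra_simps)
    also have "(N - t) * (N + t) / (2 * (N + t)) = (N - t) / 2" using False by (rule nonzero_mult_divide_mult_cancel_right)
    finally have "x\<^sup>2 - (cmod y)\<^sup>2 = t" unfolding x2 by argo
    then have "complex_of_real x * of_real x - y * cnj y = of_real t"
      by (metis complex_norm_square of_real_diff of_real_mult power2_eq_square)
    then have "qa s = \<i> * (of_real x * of_real x - y * cnj y)"
      using t[OF t_def] by simp
    then have "qa s = qa (Quat (of_real x) y * quat_k * qcnj (Quat (of_real x) y))"
      by (simp add: algebra_simps)
    moreover have "qb s = qb (Quat (of_real x) y * quat_k * qcnj (Quat (of_real x) y))"
      using x by (simp add: y_def field_simps)
    ultimately show ?thesis by (intro exI quat_eqI)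
  qed
qed

section \<open>Lagrange diagonalization of skew-Hermitian quaternionic forms\<close>

definition skew_on :: "'a set \<Rightarrow> ('a \<Rightarrow> 'a \<Rightarrow> quat) \<Rightarrow> bool" where
  "skew_on I S \<longleftrightarrow> (\<forall>i\<in>I. \<forall>j\<in>I. S j i = - qcnj (S i j))"

definition k_factor_on :: "'a set \<Rightarrow> ('a \<Rightarrow> 'a \<Rightarrow> quat) \<Rightarrow> ('a \<Rightarrow> 'a \<Rightarrow> quat) \<Rightarrow> bool" where
  "k_factor_on I S r \<longleftrightarrow> (\<forall>i\<in>I. \<forall>j\<in>I. S i j = (\<Sum>l\<in>I. r i l * quat_k * qcnj (r j l)))"

text \<open>Schur complement: subtracting \<open>S i m * inverse s * S m j\<close> clears row and
  column \<open>m\<close> and leaves a skew form on the other indices. As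
  \<open>s = q * quat_k * qcnj q\<close>, the subtracted form is
  \<open>u i * quat_k * qcnj (u j)\<close> with \<open>u i = S i m * inverse s * q\<close>, which
  becomes column \<open>m\<close> of the factor.\<close>

lemma skew_k_factor_pivot:
  assumes I: "finite I" "m \<in> I" and S: "skew_on I S" and m: "S m m \<noteq> 0"
    and IH: "\<And>S. skew_on (I - {m}) S \<Longrightarrow> \<exists>r. k_factor_on (I - {m}) S r"
  shows "\<exists>r. k_factor_on I S r"
proof -
  define s where "s = S m m"
  have skew: "qcnj (S i j) = - S j i" if "i \<in> I" "j \<in> I" for i j
    using S that unfolding skew_on_def by (metis minus_minus)
  have s: "s \<noteq> 0" "qcnj s = - s" using m skew I unfolding s_def by auto
  have cancel: "s * (inverse s * x) = x" for x
    using s(1) by (simp flip: mult.assoc)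
  obtain q where q: "s = q * quat_k * qcnj q" using pure_quat_conj_k[OF s(2)] by blast
  define S1 where "S1 i j = S i j - S i m * inverse s * S m j" for i j
  have "skew_on (I - {m}) S1"
    unfolding skew_on_def S1_def using I
    by (auto simp: skew qcnj_inverse s(2) mult.assoc inverse_minus_eq)
  then obtain r where r: "k_factor_on (I - {m}) S1 r" using IH by blast
  define r' where "r' i l = (if l = m then S i m * inverse s * q else if i = m then 0 else r i l)"
    for i l
  have "S i j = (\<Sum>l\<in>I. r' i l * quat_k * qcnj (r' j l))" if ij: "i \<in> I" "j \<in> I" for i j
  proof -
    have "r' i m * quat_k * qcnj (r' j m)
      = S i m * inverse s * (q * quat_k * qcnj q) * (qcnj (inverse s) * qcnj (S j m))"
      by (simp add: r'_def mult.assoc)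
    also have "\<dots> = S i m * inverse s * S m j"
      using ij I s unfolding q[symmetric] by (simp add: skew qcnj_inverse mult.assoc)
    finally have 1: "r' i m * quat_k * qcnj (r' j m) = S i m * inverse s * S m j" .
    have 2: "(\<Sum>l\<in>I-{m}. r' i l * quat_k * qcnj (r' j l)) = S1 i j"
    proof (cases "i = m \<or> j = m")
      case True
      then have "S1 i j = 0"
        using s(1) by (auto simp: S1_def s_def[symmetric] mult.assoc cancel)
      moreover have "(\<Sum>l\<in>I-{m}. r' i l * quat_k * qcnj (r' j l)) = 0"
        using True by (intro sum.neutral) (auto simp: r'_def)
      ultimately show ?thesis by simp
    next
      case False
      then have "S1 i j = (\<Sum>l\<in>I-{m}. r i l * quat_k * qcnj (r j l))"
        using r ij unfolding k_factor_on_def by blast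
      also have "\<dots> = (\<Sum>l\<in>I-{m}. r' i l * quat_k * qcnj (r' j l))"
        using False by (intro sum.cong) (auto simp: r'_def)
      finally show ?thesis by simp
    qed
    show ?thesis
      using I by (subst sum.remove[of I m]) (simp_all add: 1 2 S1_def)
  qed
  then show ?thesis unfolding k_factor_on_def by blast
qed

text \<open>A \<open>c\<close> with \<open>c * x = k\<close> will do. When the diagonal vanishes, a
  congruence creates the diagonal entry \<open>c * x - qcnj (c * x)\<close>, which has to be nonzero
  to serve as pivot.\<close>

lemma qcnj_neq_self: "x \<noteq> 0 \<Longrightarrow> \<exists>c. c * x \<noteq> qcnj (c * x)"
proof -
  assume "x \<noteq> 0"
  then have "quat_k * inverse x * x = quat_k" by (simp add: mult.assoc)
  moreover have "quat_k \<noteq> qcnj quat_k"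
    by (auto simp: quat_k_def qcnj_def complex_eq_iff)
  ultimately show ?thesis by metis
qed

theorem skew_k_factor:
  assumes "finite I" "skew_on I S"
  shows "\<exists>r. k_factor_on I S r"
  using assms
proof (induction "card I" arbitrary: I S)
  case 0
  then show ?case by (simp add: k_factor_on_def)
next
  case (Suc n)
  have IH: "\<exists>r. k_factor_on (I - {m}) S r" if "m \<in> I" "skew_on (I - {m}) S" for m S
  proof (rule Suc.hyps(1))
    show "n = card (I - {m})" using Suc.hyps(2) Suc.prems(1) that(1) by simp
  qed (use Suc.prems(1) that(2) in auto)
  have skew: "qcnj (S i j) = - S j i" if "i \<in> I" "j \<in> I" for i j
    using Suc.prems(2) that unfolding skew_on_def by (metis minus_minus)
  consider (diag) m where "m \<in> I" "S m m \<noteq> 0"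
    | (zero) "\<forall>i\<in>I. \<forall>j\<in>I. S i j = 0"
    | (off) m l where "m \<in> I" "l \<in> I" "S l m \<noteq> 0" "S m m = 0" "S l l = 0"
    by blast
  then show ?case
  proof cases
    case diag
    then show ?thesis
      by (intro skew_k_factor_pivot[OF Suc.prems(1) diag(1) Suc.prems(2) diag(2)] IH)
  next
    case zero
    then show ?thesis by (intro exI[of _ "\<lambda>_ _. 0"]) (simp add: k_factor_on_def)
  next
    case off
    then have ml: "m \<noteq> l" by auto
    obtain c where c: "c * S l m \<noteq> qcnj (c * S l m)" using qcnj_neq_self[OF off(3)] by blast
    (* The elementary congruence by 1 + c E_ml makes the diagonal entry at m nonzero. *)
    define e where "e i = (if i = m then c else 0)" for i
    have e: "e m = c" "e l = 0" using ml by (auto simp: e_def)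
    \<comment> \<open>The full congruence has a further term
      \<open>e i * S l l * qcnj (e j)\<close>; it vanishes since \<open>S l l = 0\<close>.\<close>
    define S2 where "S2 i j = S i j + e i * S l j + S i l * qcnj (e j)" for i j
    have "skew_on I S2"
      unfolding skew_on_def S2_def using off(2) by (simp add: skew)
    moreover have "S2 m m \<noteq> 0"
      using c skew[OF off(2,1)] by (simp add: S2_def e off(4) eq_neg_iff_add_eq_0)
    ultimately have "\<exists>r. k_factor_on I S2 r"
      by (intro skew_k_factor_pivot[OF Suc.prems(1) off(1)] IH off(1))
    then obtain r where r: "k_factor_on I S2 r" ..
    define f where "f i j = (\<Sum>t\<in>I. r i t * quat_k * qcnj (r j t))" for i j
    have f: "f i j = S2 i j" if "i \<in> I" "j \<in> I" for i j
      using r that unfolding k_factor_on_def f_def by metis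
    \<comment> \<open>Undoes the congruence: \<open>1 - c E_ml\<close> is the inverse of
      \<open>1 + c E_ml\<close> because \<open>m\<close> and \<open>l\<close> differ.\<close>
    define r' where "r' i t = r i t - e i * r l t" for i t
    have "S i j = (\<Sum>t\<in>I. r' i t * quat_k * qcnj (r' j t))" if ij: "i \<in> I" "j \<in> I" for i j
    proof -
      have "(\<Sum>t\<in>I. r' i t * quat_k * qcnj (r' j t))
        = f i j - e i * f l j - f i l * qcnj (e j) + e i * f l l * qcnj (e j)"
        by (simp add: r'_def f_def left_diff_distrib right_diff_distrib mult.assoc
            sum.distrib sum_subtractf sum_distrib_left sum_distrib_right)
      also have "\<dots> = S i j"
        by (simp add: f ij off(2) S2_def e off(5))
      finally show ?thesis by simp
    qed
    then show ?thesis unfolding k_factor_on_def by blast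
  qed
qed

subsection \<open>Matrices of disc-rational functions\<close>

lemma mat_mult_entry:
  assumes "A \<in> carrier_mat n n" "B \<in> carrier_mat n n" "i < n" "j < n"
  shows "(A * B) $$ (i, j) = (\<Sum>l<n. A $$ (i, l) * B $$ (l, j))"
  using assms by (auto simp: scalar_prod_def atLeast0LessThan intro!: sum.cong)

lemma mat_eq_mult_cancel:
  fixes A :: "'a :: comm_ring_1 mat"
  assumes "A \<in> carrier_mat n n" "B \<in> carrier_mat n n" "C \<in> carrier_mat n n" "A * B = 1\<^sub>m n"
  shows "A * (B * C) = C"
  using assms by (simp add: assoc_mult_mat[symmetric, of A n n B n C n])

text \<open>The adjugate formula shows at once that the inverse is rational in the entries, with
  poles only at zeros of the determinant.\<close>

definition mat_inv :: "'a :: field mat \<Rightarrow> 'a mat" where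
  "mat_inv A = inverse (det A) \<cdot>\<^sub>m adj_mat A"

lemma mat_inv_carrier [simp]: "A \<in> carrier_mat n n \<Longrightarrow> mat_inv A \<in> carrier_mat n n"
  by (simp add: mat_inv_def adj_mat(1))

lemma mat_inv:
  assumes "A \<in> carrier_mat n n" "det A \<noteq> 0"
  shows "A * mat_inv A = 1\<^sub>m n" "mat_inv A * A = 1\<^sub>m n"
proof -
  note adj = adj_mat[OF assms(1)]
  have "A * mat_inv A = inverse (det A) \<cdot>\<^sub>m (A * adj_mat A)"
    unfolding mat_inv_def using assms(1) adj(1) by (simp add: mult_smult_distrib)
  then show "A * mat_inv A = 1\<^sub>m n"
    using assms(2) unfolding adj(2) by (intro eq_matI) auto
  have "mat_inv A * A = inverse (det A) \<cdot>\<^sub>m (adj_mat A * A)"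
    unfolding mat_inv_def using assms(1) adj(1) by (simp add: mult_smult_assoc_mat)
  then show "mat_inv A * A = 1\<^sub>m n"
    using assms(2) unfolding adj(3) by (intro eq_matI) auto
qed

lemma det_nonzero_if_mult_one:
  fixes A :: "'a :: comm_ring_1 mat"
  assumes "A \<in> carrier_mat n n" "B \<in> carrier_mat n n" "A * B = 1\<^sub>m n"
  shows "det A \<noteq> 0" "det B \<noteq> 0"
  using det_mult[OF assms(1,2)] assms(3) by auto

lemma det_nonzero_transversal:
  fixes A :: "'a :: idom mat"
  assumes "A \<in> carrier_mat n n" "det A \<noteq> 0"
  obtains \<pi> where "\<pi> permutes {0..<n}" "\<And>i. i < n \<Longrightarrow> A $$ (i, \<pi> i) \<noteq> 0"
proof -
  have "\<exists>\<pi>\<in>{p. p permutes {0..<n}}. signof \<pi> * (\<Prod>i = 0..<n. A $$ (i, \<pi> i)) \<noteq> 0"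
    using assms unfolding det_def'[OF assms(1)] by (metis (no_types, lifting) sum.neutral)
  then obtain \<pi> where "\<pi> permutes {0..<n}" "(\<Prod>i = 0..<n. A $$ (i, \<pi> i)) \<noteq> 0" by auto
  then show thesis by (intro that[of \<pi>]) (auto simp: prod_zero_iff)
qed

text \<open>In the Leibniz formula, \<open>\<Sum>e\<^bsub>\<pi>(i)\<^esub> = \<Sum>e\<^sub>i\<close>, so a nonzero term only uses entries with
  \<open>e\<^sub>i = e\<^bsub>\<pi>(i)\<^esub>\<close>.\<close>

lemma det_weight_triangular_cong:
  fixes A B :: "'a :: comm_ring_1 mat" and e :: "nat \<Rightarrow> int"
  assumes A: "A \<in> carrier_mat n n" and B: "B \<in> carrier_mat n n"
    and zero: "\<And>i j. i < n \<Longrightarrow> j < n \<Longrightarrow> e i < e j \<Longrightarrow> A $$ (i, j) = 0 \<and> B $$ (i, j) = 0"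
    and eq: "\<And>i j. i < n \<Longrightarrow> j < n \<Longrightarrow> e i = e j \<Longrightarrow> A $$ (i, j) = B $$ (i, j)"
  shows "det A = det B"
  unfolding det_def'[OF A] det_def'[OF B]
proof (intro sum.cong refl arg_cong2[of _ _ _ _ "(*)"])
  fix p assume "p \<in> {p. p permutes {0..<n}}"
  then have p: "p permutes {0..<n}" by simp
  have lt: "p i < n" if "i < n" for i using permutes_in_image[OF p, of i] that by simp
  show "(\<Prod>i = 0..<n. A $$ (i, p i)) = (\<Prod>i = 0..<n. B $$ (i, p i))"
  proof (cases "\<exists>i<n. e i < e (p i)")
    case True
    then obtain i where i: "i < n" "e i < e (p i)" by blast
    with zero lt have "A $$ (i, p i) = 0" "B $$ (i, p i) = 0" by blast+
    with i have "(\<Prod>i = 0..<n. A $$ (i, p i)) = 0" "(\<Prod>i = 0..<n. B $$ (i, p i)) = 0"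
      by (auto intro!: prod_zero)
    then show ?thesis by simp
  next
    case False
    have "(\<Sum>i = 0..<n. e (p i)) = (\<Sum>i = 0..<n. e i)"
      using sum.permute[OF p, of e] by (simp add: comp_def)
    then have "(\<Sum>i = 0..<n. e i - e (p i)) = 0" by (simp add: sum_subtractf)
    moreover have "0 \<le> e i - e (p i)" if "i \<in> {0..<n}" for i
    proof -
      have "\<not> e i < e (p i)" using False that by auto
      then show ?thesis by simp
    qed
    ultimately have "\<forall>i\<in>{0..<n}. e i - e (p i) = 0"
      by (subst (asm) sum_nonneg_eq_0_iff) auto
    then show ?thesis by (intro prod.cong refl eq lt) auto
  qed
qed

section \<open>Matrix functions that are rational on the closed disc\<close>

definition mat_rational :: "nat \<Rightarrow> (complex \<Rightarrow> complex mat) \<Rightarrow> bool" where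
  "mat_rational n F \<longleftrightarrow> (\<forall>z. F z \<in> carrier_mat n n) \<and>
     (\<forall>i<n. \<forall>j<n. disc_rational (\<lambda>z. F z $$ (i, j)))"

lemma mat_rational_carrier: "mat_rational n F \<Longrightarrow> F z \<in> carrier_mat n n"
  by (simp add: mat_rational_def)

lemma mat_rational_entry:
  "mat_rational n F \<Longrightarrow> i < n \<Longrightarrow> j < n \<Longrightarrow> disc_rational (\<lambda>z. F z $$ (i, j))"
  by (simp add: mat_rational_def)

lemma mat_rational_mult:
  assumes "mat_rational n F" "mat_rational n G"
  shows "mat_rational n (\<lambda>z. F z * G z)"
  unfolding mat_rational_def
proof (intro conjI allI impI)
  fix i j assume "i < n" "j < n"
  then have "(\<lambda>z. (F z * G z) $$ (i, j)) = (\<lambda>z. \<Sum>l<n. F z $$ (i, l) * G z $$ (l, j))"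
    using assms by (intro ext mat_mult_entry) (auto simp: mat_rational_def)
  moreover have "disc_rational (\<lambda>z. \<Sum>l<n. F z $$ (i, l) * G z $$ (l, j))"
    using assms \<open>i < n\<close> \<open>j < n\<close>
    by (intro disc_rational_sum disc_rational_mult) (auto simp: mat_rational_def)
  ultimately show "disc_rational (\<lambda>z. (F z * G z) $$ (i, j))" by simp
qed (use assms in \<open>auto simp: mat_rational_def intro!: mult_carrier_mat\<close>)

lemma mat_rational_add:
  assumes "mat_rational n F" "mat_rational n G"
  shows "mat_rational n (\<lambda>z. F z + G z)"
  unfolding mat_rational_def
proof (intro conjI allI impI)
  fix i j assume "i < n" "j < n"
  moreover from this have "(\<lambda>z. (F z + G z) $$ (i, j)) = (\<lambda>z. F z $$ (i, j) + G z $$ (i, j))"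
    using mat_rational_carrier[OF assms(2)] by (intro ext) (metis index_add_mat(1) carrier_matD)
  ultimately show "disc_rational (\<lambda>z. (F z + G z) $$ (i, j))"
    using assms by (auto simp: mat_rational_def intro: disc_rational_add)
qed (use assms in \<open>auto simp: mat_rational_def\<close>)

lemma mat_rational_scale:
  assumes "mat_rational n F" "disc_rational f"
  shows "mat_rational n (\<lambda>z. f z \<cdot>\<^sub>m F z)"
  unfolding mat_rational_def
proof (intro conjI allI impI)
  fix i j assume "i < n" "j < n"
  moreover from this have "(\<lambda>z. (f z \<cdot>\<^sub>m F z) $$ (i, j)) = (\<lambda>z. f z * F z $$ (i, j))"
    using assms(1) mat_rational_carrier[OF assms(1)] by (intro ext) (metis index_smult_mat(1) carrier_matD)
  ultimately show "disc_rational (\<lambda>z. (f z \<cdot>\<^sub>m F z) $$ (i, j))"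
    using assms by (auto simp: mat_rational_def intro: disc_rational_mult)
qed (use assms in \<open>auto simp: mat_rational_def\<close>)

lemma mat_rational_const: "A \<in> carrier_mat n n \<Longrightarrow> mat_rational n (\<lambda>_. A)"
  by (simp add: mat_rational_def)

lemma mat_rational_det:
  assumes "mat_rational n F"
  shows "disc_rational (\<lambda>z. det (F z))"
proof -
  have "disc_rational (\<lambda>z. \<Sum>p | p permutes {0..<n}. signof p * (\<Prod>i = 0..<n. F z $$ (i, p i)))"
  proof (intro disc_rational_sum disc_rational_mult disc_rational_prod disc_rational_const)
    fix p i assume "p \<in> {p. p permutes {0..<n}}" "i \<in> {0..<n}"
    then have "p i < n" "i < n" using permutes_in_image[of p "{0..<n}" i] by auto
    then show "disc_rational (\<lambda>z. F z $$ (i, p i))" using assms by (simp add: mat_rational_def)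
  qed
  then show ?thesis
    by (rule disc_rational_cong) (simp add: det_def'[OF mat_rational_carrier[OF assms]])
qed

lemma mat_rational_delete:
  assumes "mat_rational n F" "k < n" "l < n"
  shows "mat_rational (n - 1) (\<lambda>z. mat_delete (F z) k l)"
  unfolding mat_rational_def
proof (intro conjI allI impI)
  fix i j assume ij: "i < n - 1" "j < n - 1"
  define i' where "i' = (if i < k then i else Suc i)"
  define j' where "j' = (if j < l then j else Suc j)"
  have "i' < n" "j' < n" using ij by (auto simp: i'_def j'_def)
  then have "disc_rational (\<lambda>z. F z $$ (i', j'))" using assms(1) by (simp add: mat_rational_def)
  moreover have "F z $$ (i', j') = mat_delete (F z) k l $$ (i, j)" for z
    using ij mat_rational_carrier[OF assms(1), of z]
    by (simp add: mat_delete_def i'_def j'_def)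
  ultimately show "disc_rational (\<lambda>z. mat_delete (F z) k l $$ (i, j))" by simp
qed (use assms in \<open>auto simp: mat_rational_def intro: mat_delete_carrier simp del: One_nat_def\<close>)

lemma mat_rational_inv:
  assumes F: "mat_rational n F" and "\<And>z. cmod z \<le> 1 \<Longrightarrow> det (F z) \<noteq> 0"
  shows "mat_rational n (\<lambda>z. mat_inv (F z))"
  unfolding mat_inv_def
proof (rule mat_rational_scale)
  show "disc_rational (\<lambda>z. inverse (det (F z)))"
    using assms by (intro disc_rational_inverse mat_rational_det)
  show "mat_rational n (\<lambda>z. adj_mat (F z))"
    unfolding mat_rational_def
  proof (intro conjI allI impI)
    fix i j assume ij: "i < n" "j < n"
    have "disc_rational (\<lambda>z. (-1) ^ (j + i) * det (mat_delete (F z) j i))"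
      using F ij by (intro disc_rational_mult disc_rational_const mat_rational_det[where n = "n - 1"]
          mat_rational_delete)
    moreover have "(-1) ^ (j + i) * det (mat_delete (F z) j i) = adj_mat (F z) $$ (i, j)" for z
      using ij mat_rational_carrier[OF F, of z] by (simp add: adj_mat_def cofactor_def)
    ultimately show "disc_rational (\<lambda>z. adj_mat (F z) $$ (i, j))" by simp
  qed (use F adj_mat(1) in \<open>auto simp: mat_rational_def\<close>)
qed

lemma cadj_carrier [simp]: "A \<in> carrier_mat n m \<Longrightarrow> cadj A \<in> carrier_mat m n"
  by (simp add: cadj_def)

lemma cadj_entry [simp]:
  "A \<in> carrier_mat n n \<Longrightarrow> i < n \<Longrightarrow> j < n \<Longrightarrow> cadj A $$ (i, j) = cnj (A $$ (j, i))"
  by (simp add: cadj_def)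

lemma cadj_mult:
  assumes A: "A \<in> carrier_mat n n" and B: "B \<in> carrier_mat n n"
  shows "cadj (A * B) = cadj B * cadj A"
proof (rule eq_matI)
  fix i j assume "i < dim_row (cadj B * cadj A)" "j < dim_col (cadj B * cadj A)"
  with A B have ij: "i < n" "j < n" by (auto simp: cadj_def)
  with A B show "cadj (A * B) $$ (i, j) = (cadj B * cadj A) $$ (i, j)"
    by (simp add: mat_mult_entry[OF cadj_carrier[OF B] cadj_carrier[OF A]]
        mat_mult_entry[OF A B] cadj_entry[OF mult_carrier_mat[OF A B]] mult.commute
        del: index_mult_mat(1))
qed (use A B in \<open>auto simp: cadj_def\<close>)

lemma cadj_cadj: "cadj (cadj A) = A"
  by (rule eq_matI) (auto simp: cadj_def)

lemma cadj_one [simp]: "cadj (1\<^sub>m n) = 1\<^sub>m n"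
  by (rule eq_matI) (auto simp: cadj_def)

lemma det_cadj:
  assumes A: "A \<in> carrier_mat n n"
  shows "det (cadj A) = cnj (det A)"
proof -
  have "cadj A = map_mat cnj (transpose_mat A)" by (rule eq_matI) (auto simp: cadj_def)
  moreover have "comm_ring_hom cnj" by unfold_locales auto
  ultimately show ?thesis using A by (simp add: comm_ring_hom.hom_det det_transpose)
qed

lemma mat_rational_cadj:
  assumes "mat_rational n F"
  shows "mat_rational n (\<lambda>z. cadj (F (cnj z)))"
  unfolding mat_rational_def
proof (intro conjI allI impI)
  fix i j assume ij: "i < n" "j < n"
  then have "disc_rational (\<lambda>z. cnj (F (cnj z) $$ (j, i)))"
    using assms disc_rational_cnj[of "\<lambda>z. F z $$ (j, i)"] by (simp add: mat_rational_def)
  moreover have "cadj (F (cnj z)) $$ (i, j) = cnj (F (cnj z) $$ (j, i))" for z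
    using mat_rational_carrier[OF assms] ij by (rule cadj_entry)
  ultimately show "disc_rational (\<lambda>z. cadj (F (cnj z)) $$ (i, j))" by simp
qed (use assms in \<open>auto simp: mat_rational_def\<close>)

definition diag_pow :: "nat \<Rightarrow> (nat \<Rightarrow> int) \<Rightarrow> complex \<Rightarrow> complex mat" where
  "diag_pow n e z = mat n n (\<lambda>(i, j). if i = j then z powi e i else 0)"

lemma diag_pow_carrier [simp]: "diag_pow n e z \<in> carrier_mat n n"
  by (simp add: diag_pow_def)

lemma diag_pow_mult_entry:
  assumes A: "A \<in> carrier_mat n n" and "i < n" "j < n"
  shows "(diag_pow n e z * A) $$ (i, j) = z powi e i * A $$ (i, j)"
    and "(A * diag_pow n e z) $$ (i, j) = A $$ (i, j) * z powi e j"
proof -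
  have "(diag_pow n e z * A) $$ (i, j) = (\<Sum>l<n. if l = i then z powi e i * A $$ (i, j) else 0)"
    unfolding mat_mult_entry[OF diag_pow_carrier assms]
    using assms by (intro sum.cong) (auto simp: diag_pow_def)
  then show "(diag_pow n e z * A) $$ (i, j) = z powi e i * A $$ (i, j)" using assms by simp
  have "(A * diag_pow n e z) $$ (i, j) = (\<Sum>l<n. if l = j then A $$ (i, j) * z powi e j else 0)"
    unfolding mat_mult_entry[OF A diag_pow_carrier assms(2,3)]
    using assms by (intro sum.cong) (auto simp: diag_pow_def)
  then show "(A * diag_pow n e z) $$ (i, j) = A $$ (i, j) * z powi e j" using assms by simp
qed

lemma det_diag_pow:
  assumes "z \<noteq> 0"
  shows "det (diag_pow n e z) = z powi (\<Sum>i<n. e i)"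
proof -
  have "det (diag_pow n e z) = prod_list (diag_mat (diag_pow n e z))"
    by (rule det_upper_triangular[of _ n]) (auto simp: diag_pow_def)
  also have "\<dots> = (\<Prod>i<n. z powi e i)"
    unfolding prod_list_diag_prod by (simp add: diag_pow_def atLeast0LessThan)
  also have "\<dots> = z powi (\<Sum>i<n. e i)"
    using assms by (induction n) (auto simp: power_int_add)
  finally show ?thesis .
qed

subsection \<open>The quaternionic structure\<close>

text \<open>Row \<open>i\<close> of \<open>sigy_blk d\<close> has a single nonzero entry,
  \<open>- \<i> * qsgn i\<close> in column \<open>qsw i\<close>, the partner of \<open>i\<close> in
  its block.\<close>

definition qsw :: "nat \<Rightarrow> nat" where
  "qsw i = (if even i then i + 1 else i - 1)"

definition qsgn :: "nat \<Rightarrow> complex" where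
  "qsgn i = (if even i then 1 else -1)"

lemma qsw_less [simp]: "i < 2 * d \<Longrightarrow> qsw i < 2 * d"
  unfolding qsw_def by (cases "even i") (auto elim!: evenE)

lemma qsw_qsw [simp]: "qsw (qsw i) = i"
  by (auto simp: qsw_def)

lemma qsw_div_2 [simp]: "qsw i div 2 = i div 2"
  by (auto simp: qsw_def elim!: evenE oddE)

lemma eq_if_div_2_eq:
  assumes "i div 2 = j div 2" "j \<noteq> qsw i"
  shows "i = j"
proof (cases "even i")
  case True
  then have "j \<noteq> i + 1" using assms(2) by (simp add: qsw_def)
  then show ?thesis using assms(1) True by presburger
next
  case False
  then have "j \<noteq> i - 1" using assms(2) by (simp add: qsw_def)
  then show ?thesis using assms(1) False by presburger
qed

lemma qsgn_simps [simp]: "qsgn (qsw i) = - qsgn i" "qsgn i * qsgn i = 1"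
  "qsgn i * (qsgn i * x) = x" "qsgn i * (qsgn j * (qsgn i * qsgn j)) = 1" "cnj (qsgn i) = qsgn i" "qsgn i \<noteq> 0"
  by (auto simp: qsgn_def qsw_def)

text \<open>Entrywise form of conjugating all entries and multiplying by \<open>sigy_blk d\<close>
  on both sides: a conjugate-linear ring involution whose fixed points are the quaternionic
  matrices.\<close>

definition qtau :: "nat \<Rightarrow> complex mat \<Rightarrow> complex mat" where
  "qtau d X = mat (2 * d) (2 * d) (\<lambda>(i, j). qsgn i * qsgn j * cnj (X $$ (qsw i, qsw j)))"

lemma qtau_carrier [simp]: "qtau d X \<in> carrier_mat (2 * d) (2 * d)"
  by (simp add: qtau_def)

lemma qtau_entry [simp]:
  "i < 2 * d \<Longrightarrow> j < 2 * d \<Longrightarrow> qtau d X $$ (i, j) = qsgn i * qsgn j * cnj (X $$ (qsw i, qsw j))"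
  by (simp add: qtau_def)

lemma qtau_dim [simp]: "dim_row (qtau d X) = 2 * d" "dim_col (qtau d X) = 2 * d"
  by (simp_all add: qtau_def)

lemma sum_qsw: "(\<Sum>l<2 * d. f (qsw l)) = (\<Sum>l<2 * d. f l)"
  by (rule sum.reindex_bij_witness[of _ qsw qsw]) auto

lemma qtau_mult:
  assumes X: "X \<in> carrier_mat (2 * d) (2 * d)" and Y: "Y \<in> carrier_mat (2 * d) (2 * d)"
  shows "qtau d (X * Y) = qtau d X * qtau d Y"
proof (rule eq_matI)
  fix i j assume "i < dim_row (qtau d X * qtau d Y)" "j < dim_col (qtau d X * qtau d Y)"
  then have ij: "i < 2 * d" "j < 2 * d" by auto
  have "qtau d (X * Y) $$ (i, j)
      = qsgn i * qsgn j * (\<Sum>l<2*d. cnj (X $$ (qsw i, l)) * cnj (Y $$ (l, qsw j)))"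
    using ij by (simp add: mat_mult_entry[OF X Y] del: index_mult_mat(1))
  also have "\<dots> = qsgn i * qsgn j * (\<Sum>l<2*d. cnj (X $$ (qsw i, qsw l)) * cnj (Y $$ (qsw l, qsw j)))"
    using sum_qsw[of "\<lambda>l. cnj (X $$ (qsw i, l)) * cnj (Y $$ (l, qsw j))" d] by simp
  also have "\<dots> = (\<Sum>l<2*d. qtau d X $$ (i, l) * qtau d Y $$ (l, j))"
    unfolding sum_distrib_left using ij by (intro sum.cong) (auto simp: mult_ac)
  also have "\<dots> = (qtau d X * qtau d Y) $$ (i, j)"
    using ij by (simp add: mat_mult_entry[OF qtau_carrier qtau_carrier] del: index_mult_mat(1))
  finally show "qtau d (X * Y) $$ (i, j) = (qtau d X * qtau d Y) $$ (i, j)" .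
qed auto

lemma qtau_qtau:
  assumes "X \<in> carrier_mat (2 * d) (2 * d)"
  shows "qtau d (qtau d X) = X"
  using assms by (intro eq_matI) (auto simp: mult.assoc)

lemma qtau_one [simp]: "qtau d (1\<^sub>m (2 * d)) = 1\<^sub>m (2 * d)"
proof (rule eq_matI)
  fix i j assume "i < dim_row (1\<^sub>m (2 * d) :: complex mat)" "j < dim_col (1\<^sub>m (2 * d) :: complex mat)"
  then have ij: "i < 2 * d" "j < 2 * d" by auto
  have "qsw i = qsw j \<longleftrightarrow> i = j" by (metis qsw_qsw)
  then show "qtau d (1\<^sub>m (2 * d)) $$ (i, j) = 1\<^sub>m (2 * d) $$ (i, j)" using ij by auto
qed auto

lemma qtau_add:
  assumes "X \<in> carrier_mat (2 * d) (2 * d)" "Y \<in> carrier_mat (2 * d) (2 * d)"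
  shows "qtau d (X + Y) = qtau d X + qtau d Y"
  using assms by (intro eq_matI) (auto simp: ring_distribs)

lemma qtau_smult:
  assumes "X \<in> carrier_mat (2 * d) (2 * d)"
  shows "qtau d (c \<cdot>\<^sub>m X) = cnj c \<cdot>\<^sub>m qtau d X"
  using assms by (intro eq_matI) auto

lemma qtau_diag_pow:
  assumes "\<And>i. i < 2 * d \<Longrightarrow> e (qsw i) = e i"
  shows "qtau d (diag_pow (2 * d) e (cnj z)) = diag_pow (2 * d) e z"
proof (rule eq_matI)
  fix i j assume "i < dim_row (diag_pow (2 * d) e z)" "j < dim_col (diag_pow (2 * d) e z)"
  then have ij: "i < 2 * d" "j < 2 * d" by (auto simp: diag_pow_def)
  have "qsw i = qsw j \<longleftrightarrow> i = j" by (metis qsw_qsw)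
  then show "qtau d (diag_pow (2 * d) e (cnj z)) $$ (i, j) = diag_pow (2 * d) e z $$ (i, j)"
    using ij assms by (auto simp: diag_pow_def)
qed (auto simp: diag_pow_def)

lemma qtau_cadj:
  assumes "X \<in> carrier_mat (2 * d) (2 * d)"
  shows "qtau d (cadj X) = cadj (qtau d X)"
  using assms by (intro eq_matI) (auto simp: cadj_def)

lemma sigy_blk_entry:
  assumes "i < 2 * d" "j < 2 * d"
  shows "sigy_blk d $$ (i, j) = (if j = qsw i then - \<i> * qsgn i else 0)"
proof (cases "j = qsw i")
  case True
  show ?thesis
  proof (cases "even i")
    case even: True
    then obtain b where b: "i = 2 * b" by (rule evenE)
    then have "j = 2 * b + 1" using True even by (simp add: qsw_def)
    then show ?thesis using assms True unfolding b by (simp add: sigy_blk_def qsgn_def)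
  next
    case odd: False
    then obtain b where b: "i = 2 * b + 1" by (rule oddE)
    then have "j = 2 * b" using True odd by (simp add: qsw_def)
    then show ?thesis using assms True unfolding b by (simp add: sigy_blk_def qsgn_def)
  qed
next
  case False
  have "sigy_blk d $$ (i, j) = 0"
  proof (cases "i div 2 = j div 2")
    case True
    then have "i = j" using False eq_if_div_2_eq by blast
    moreover have "j mod 2 = Suc 0 \<or> j mod 2 = 0" by presburger
    ultimately show ?thesis using assms by (auto simp: sigy_blk_def)
  qed (use assms in \<open>simp add: sigy_blk_def\<close>)
  then show ?thesis using False by simp
qed

lemma quat_mat_iff_qtau:
  "quat_mat d Q \<longleftrightarrow> Q \<in> carrier_mat (2 * d) (2 * d) \<and> qtau d Q = Q"
proof -
  have "sigy_blk d * map_mat cnj Q * sigy_blk d = qtau d Q" if Q: "Q \<in> carrier_mat (2 * d) (2 * d)"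
  proof (rule eq_matI)
    fix i j assume "i < dim_row (qtau d Q)" "j < dim_col (qtau d Q)"
    then have ij: "i < 2 * d" "j < 2 * d" by auto
    have s: "sigy_blk d \<in> carrier_mat (2 * d) (2 * d)" by (simp add: sigy_blk_def)
    have c: "map_mat cnj Q \<in> carrier_mat (2 * d) (2 * d)" using Q by simp
    have 1: "(sigy_blk d * map_mat cnj Q) $$ (i, l) = - \<i> * qsgn i * cnj (Q $$ (qsw i, l))"
      if "l < 2 * d" for l
    proof -
      have "(sigy_blk d * map_mat cnj Q) $$ (i, l)
        = (\<Sum>k<2*d. if k = qsw i then - \<i> * qsgn i * cnj (Q $$ (qsw i, l)) else 0)"
        unfolding mat_mult_entry[OF s c ij(1) that]
        using ij that Q by (intro sum.cong) (auto simp: sigy_blk_entry)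
      then show ?thesis using ij by simp
    qed
    have "(sigy_blk d * map_mat cnj Q * sigy_blk d) $$ (i, j)
      = (\<Sum>l<2*d. if l = qsw j then qsgn i * qsgn j * cnj (Q $$ (qsw i, qsw j)) else 0)"
      unfolding mat_mult_entry[OF mult_carrier_mat[OF s c] s ij]
      using ij by (intro sum.cong) (auto simp: 1 sigy_blk_entry mult_ac simp del: index_mult_mat(1))
    then show "(sigy_blk d * map_mat cnj Q * sigy_blk d) $$ (i, j) = qtau d Q $$ (i, j)"
      using ij by simp
  qed (auto simp: sigy_blk_def)
  then show ?thesis unfolding quat_mat_def by auto
qed

text \<open>Identity theorem: the numerator of the difference has infinitely many zeros.\<close>

lemma disc_rational_eqI:
  assumes f: "disc_rational f" and g: "disc_rational g"
    and eq: "\<And>z. cmod z = 1 \<Longrightarrow> f z = g z" and z: "cmod z \<le> 1"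
  shows "f z = g z"
proof -
  have "disc_rational (\<lambda>z. f z + - g z)" by (intro disc_rational_add disc_rational_uminus f g)
  then obtain p q where q: "\<And>z. cmod z \<le> 1 \<Longrightarrow> poly q z \<noteq> 0"
    and p: "\<And>z. cmod z \<le> 1 \<Longrightarrow> f z + - g z = poly p z / poly q z"
    by (rule disc_rationalE) blast
  have "p = 0"
  proof (rule poly_eq_on_circle)
    fix w :: complex assume "cmod w = 1"
    then show "poly p w = poly 0 w" using p[of w] q[of w] eq[of w] by simp
  qed
  then show ?thesis using p[OF z] by simp
qed

lemma mat_rational_qtau:
  assumes "mat_rational (2 * d) F"
  shows "mat_rational (2 * d) (\<lambda>z. qtau d (F (cnj z)))"
  unfolding mat_rational_def
proof (intro conjI allI impI)
  fix i j assume ij: "i < 2 * d" "j < 2 * d"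
  then have "disc_rational (\<lambda>z. cnj (F (cnj z) $$ (qsw i, qsw j)))"
    by (intro disc_rational_cnj[of "\<lambda>z. F z $$ (qsw i, qsw j)"] mat_rational_entry[OF assms] qsw_less)
  then have "disc_rational (\<lambda>z. qsgn i * qsgn j * cnj (F (cnj z) $$ (qsw i, qsw j)))"
    by (intro disc_rational_mult disc_rational_const)
  then show "disc_rational (\<lambda>z. qtau d (F (cnj z)) $$ (i, j))" using ij by simp
qed simp

section \<open>Polynomial matrices and the Hilbert 90 step\<close>

definition mat_poly :: "nat \<Rightarrow> (complex \<Rightarrow> complex mat) \<Rightarrow> bool" where
  "mat_poly n F \<longleftrightarrow> (\<exists>p. \<forall>z. F z = mat n n (\<lambda>(i, j). poly (p i j) z))"

lemma mat_poly_rational: "mat_poly n F \<Longrightarrow> mat_rational n F"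
  by (auto simp: mat_poly_def mat_rational_def disc_rational_poly)

lemma mat_poly_mult:
  assumes "mat_poly n F" "mat_poly n G"
  shows "mat_poly n (\<lambda>z. F z * G z)"
proof -
  obtain p where p: "\<forall>z. F z = mat n n (\<lambda>(i, j). poly (p i j) z)"
    using assms(1) unfolding mat_poly_def ..
  obtain q where q: "\<forall>z. G z = mat n n (\<lambda>(i, j). poly (q i j) z)"
    using assms(2) unfolding mat_poly_def ..
  have "F z * G z = mat n n (\<lambda>(i, j). poly (\<Sum>l<n. p i l * q l j) z)" for z
    unfolding p[rule_format] q[rule_format]
    by (rule eq_matI)
      (auto simp: mat_mult_entry[of _ n] poly_sum simp del: index_mult_mat(1))
  then show ?thesis
    unfolding mat_poly_def by (intro exI[of _ "\<lambda>i j. \<Sum>l<n. p i l * q l j"] allI)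
qed

text \<open>For \<open>c\<close> on the circle the pencil is \<open>cnj c\<close> times
  \<open>X + c^2\<close>, singular only if \<open>- c^2\<close> is an eigenvalue of
  \<open>X\<close>. This excludes finitely many \<open>c\<close>.\<close>

lemma finite_det_zero_pencil:
  fixes X :: "complex mat"
  assumes X: "X \<in> carrier_mat n n"
  obtains c where "cmod c = 1" "det (c \<cdot>\<^sub>m 1\<^sub>m n + cnj c \<cdot>\<^sub>m X) \<noteq> 0"
proof -
  define q where "q = char_poly X \<circ>\<^sub>p [:0, 0, -1:]"
  have "char_poly X \<noteq> 0" using degree_monic_char_poly[OF X] by auto
  then have "q \<noteq> 0" unfolding q_def by (subst pcompose_eq_0_iff) auto
  then have "finite {c. poly q c = 0}" by (rule poly_roots_finite)
  then have "\<not> {z. cmod z = 1} \<subseteq> {c. poly q c = 0}"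
    using infinite_unit_circle finite_subset by blast
  then obtain c where c: "cmod c = 1" "poly q c \<noteq> 0" by blast
  have c2: "cnj c * c\<^sup>2 = c"
    using c(1) complex_norm_square[of c] by (simp add: power2_eq_square mult_ac)
  have "poly (char_poly X) (- (c\<^sup>2)) \<noteq> 0"
    using c(2) by (simp add: q_def poly_pcompose power2_eq_square)
  then have "det (char_matrix X (- (c\<^sup>2))) \<noteq> 0"
    using eigenvalue_det[OF X] eigenvalue_root_char_poly[OF X] by blast
  moreover have "c \<cdot>\<^sub>m 1\<^sub>m n + cnj c \<cdot>\<^sub>m X = cnj c \<cdot>\<^sub>m char_matrix X (- (c\<^sup>2))"
    using X c2 unfolding char_matrix_def by (intro eq_matI) (auto simp: distrib_left)
  moreover have "cnj c \<noteq> 0" using c(1) by auto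
  ultimately show thesis using c(1) by (intro that[of c]) auto
qed

text \<open>The factor \<open>E = P\<inverse> \<tau>(P)\<close> lies in the finite-dimensional algebra of polynomial matrices with
  \<open>deg E\<^sub>i\<^sub>j \<le> e\<^sub>i - e\<^sub>j\<close> and satisfies \<open>E \<tau>(E) = 1\<close>. As in Hilbert 90, \<open>F = c + \<bar>c\<bar> E\<close> satisfies
  \<open>E \<tau>(F) = F\<close>, so \<open>P F\<close> is quaternionic.\<close>

theorem quaternionic_left_factor:
  fixes e :: "nat \<Rightarrow> int"
  assumes P: "mat_poly (2 * d) P" and detP: "\<And>z. cmod z \<le> 1 \<Longrightarrow> det (P z) \<noteq> 0"
    and N: "mat_rational (2 * d) N" and detN: "\<And>z. cmod z \<le> 1 \<Longrightarrow> det (N z) \<noteq> 0"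
    and e: "\<And>i. i < 2 * d \<Longrightarrow> e (qsw i) = e i"
    and A: "\<And>z. cmod z = 1 \<Longrightarrow> A z = P z * diag_pow (2 * d) e z * N (cnj z)"
    and quat: "\<And>z. cmod z = 1 \<Longrightarrow> qtau d (A (cnj z)) = A z"
  shows "\<exists>Q M. mat_poly (2 * d) Q \<and> (\<forall>z. cmod z \<le> 1 \<longrightarrow> det (Q z) \<noteq> 0) \<and>
    mat_rational (2 * d) M \<and> (\<forall>z. cmod z \<le> 1 \<longrightarrow> det (M z) \<noteq> 0) \<and>
    (\<forall>z. cmod z = 1 \<longrightarrow> A z = Q z * diag_pow (2 * d) e z * M (cnj z)) \<and>
    (\<forall>z. cmod z \<le> 1 \<longrightarrow> qtau d (Q (cnj z)) = Q z)"
proof -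
  define n where "n = 2 * d"
  let ?D = "diag_pow n e"
  note P = P[folded n_def] and N = N[folded n_def]
  have Pc [simp]: "P z \<in> carrier_mat n n" for z
    using mat_rational_carrier[OF mat_poly_rational[OF P]] .
  have Nc [simp]: "N z \<in> carrier_mat n n" for z using mat_rational_carrier[OF N] .
  have tc [simp]: "qtau d X \<in> carrier_mat n n" for X by (simp add: n_def)
  note assoc = assoc_mult_mat[of _ n n _ n _ n]
  note right_one = right_mult_one_mat[of _ n n]
  note smult_distrib = mult_smult_distrib[of _ n n _ n]
  note qtau_mult = qtau_mult[of _ d, folded n_def] and qtau_one' = qtau_one[of d, folded n_def]
  have mc [simp]: "X * Y \<in> carrier_mat n n" if "X \<in> carrier_mat n n" "Y \<in> carrier_mat n n"
    for X Y :: "complex mat" using that by simp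
  define P' where "P' z = qtau d (P (cnj z))" for z
  define N' where "N' z = qtau d (N (cnj z))" for z
  have P'c [simp]: "P' z \<in> carrier_mat n n" and N'c [simp]: "N' z \<in> carrier_mat n n" for z
    by (simp_all add: P'_def N'_def)
  define P'i where "P'i z = qtau d (mat_inv (P (cnj z)))" for z
  have P'ic [simp]: "P'i z \<in> carrier_mat n n" for z by (simp add: P'i_def)
  have P'inv: "P' z * P'i z = 1\<^sub>m n" if "cmod z \<le> 1" for z
    using that mat_inv(1)[OF Pc, of "cnj z"] detP[of "cnj z"]
    by (simp add: P'_def P'i_def qtau_one' flip: qtau_mult)
  have detN': "det (N' z) \<noteq> 0" if "cmod z \<le> 1" for z
  proof -
    have "N' z * qtau d (mat_inv (N (cnj z))) = 1\<^sub>m n"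
      using that mat_inv(1)[OF Nc, of "cnj z"] detN[of "cnj z"]
      by (simp add: N'_def qtau_one' flip: qtau_mult)
    then show ?thesis by (intro det_nonzero_if_mult_one(1)[of _ n]) auto
  qed
  have P'r: "mat_rational n P'" and N'r: "mat_rational n N'"
    using mat_rational_qtau[of d P] mat_rational_qtau[of d N] mat_poly_rational[OF P] N
    by (simp_all add: P'_def[abs_def] N'_def[abs_def] n_def)
  have A': "A z = P' z * ?D z * N' (cnj z)" if z: "cmod z = 1" for z
  proof -
    have "A z = qtau d (P (cnj z) * ?D (cnj z) * N z)"
      using quat[OF z] A[of "cnj z"] z by (simp add: n_def)
    also have "\<dots> = P' z * qtau d (?D (cnj z)) * N' (cnj z)"
      by (simp add: qtau_mult P'_def N'_def)
    also have "qtau d (?D (cnj z)) = ?D z" unfolding n_def by (rule qtau_diag_pow) (rule e)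
    finally show ?thesis .
  qed
  \<comment> \<open>\<open>P D N\<close> and \<open>P' D N'\<close> are two factorizations of
    \<open>A\<close> with the same \<open>D\<close>; \<open>E\<close> and \<open>X\<close> are the
    transition matrices on its left and right, tied by \<open>E D = D X\<close> on the
    circle.\<close>
  define E where "E z = mat_inv (P z) * P' z" for z
  define X where "X z = N z * mat_inv (N' z)" for z
  have Ec [simp]: "E z \<in> carrier_mat n n" and Xc [simp]: "X z \<in> carrier_mat n n" for z
    by (simp_all add: E_def X_def)
  have [simp]: "dim_row (E z) = n" "dim_col (E z) = n" for z
    using carrier_matD[OF Ec[of z]] by simp_all
  have Er: "mat_rational n E" unfolding E_def[abs_def]
    by (intro mat_rational_mult mat_rational_inv mat_poly_rational[OF P] P'r detP)
  have Xr: "mat_rational n X" unfolding X_def[abs_def]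
    by (intro mat_rational_mult mat_rational_inv N N'r detN')
  have ED: "E z * ?D z = ?D z * X (cnj z)" if z: "cmod z = 1" for z
  proof -
    have "P' z * ?D z = P' z * ?D z * (N' (cnj z) * mat_inv (N' (cnj z)))"
      using z mat_inv(1)[OF N'c detN', of "cnj z"] by (simp add: right_one)
    also have "\<dots> = A z * mat_inv (N' (cnj z))" by (simp add: A'[OF z] assoc)
    also have "\<dots> = P z * (?D z * X (cnj z))" by (simp add: A[OF z, folded n_def] assoc X_def)
    finally have "E z * ?D z = mat_inv (P z) * (P z * (?D z * X (cnj z)))"
      by (simp add: E_def assoc)
    then show ?thesis
      using mat_eq_mult_cancel[OF mat_inv_carrier[OF Pc] Pc _ mat_inv(2)[OF Pc detP]] z by simp
  qed
  have "\<exists>p. (\<forall>z. cmod z \<le> 1 \<longrightarrow> E z $$ (i, j) = poly p z) \<and> (p = 0 \<or> int (degree p) \<le> e i - e j)"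
    if ij: "i < n" "j < n" for i j
  proof (rule disc_rational_liouville[OF mat_rational_entry[OF Er ij] mat_rational_entry[OF Xr ij]])
    fix z :: complex assume z: "cmod z = 1"
    then have z0: "z \<noteq> 0" by auto
    have "E z $$ (i, j) * z powi e j = z powi e i * X (cnj z) $$ (i, j)"
      using arg_cong[OF ED[OF z], of "\<lambda>M. M $$ (i, j)"]
      by (simp only: diag_pow_mult_entry[OF Ec ij] diag_pow_mult_entry[OF Xc ij])
    then show "E z $$ (i, j) = z powi (e i - e j) * X (cnj z) $$ (i, j)"
      using z0 by (simp add: power_int_diff field_simps)
  qed
  then obtain p where p: "\<And>i j z. i < n \<Longrightarrow> j < n \<Longrightarrow> cmod z \<le> 1 \<Longrightarrow> E z $$ (i, j) = poly (p i j) z"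
    and pd: "\<And>i j. i < n \<Longrightarrow> j < n \<Longrightarrow> p i j = 0 \<or> int (degree (p i j)) \<le> e i - e j"
    by metis
  have Etau: "E z * qtau d (E (cnj z)) = 1\<^sub>m n" if z: "cmod z \<le> 1" for z
  proof -
    have "qtau d (E (cnj z)) = P'i z * P z"
      by (simp add: E_def qtau_mult P'i_def P'_def qtau_qtau[of "P z" d, folded n_def])
    then have "E z * qtau d (E (cnj z)) = mat_inv (P z) * (P' z * (P'i z * P z))"
      by (simp add: E_def assoc)
    also have "\<dots> = mat_inv (P z) * P z"
      by (simp add: mat_eq_mult_cancel[OF P'c P'ic Pc P'inv[OF z]])
    finally show ?thesis using mat_inv(2)[OF Pc detP[OF z]] by simp
  qed
  obtain c where c: "cmod c = 1" and det0: "det (c \<cdot>\<^sub>m 1\<^sub>m n + cnj c \<cdot>\<^sub>m E 0) \<noteq> 0"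
    using finite_det_zero_pencil[OF Ec] by blast
  \<comment> \<open>Built from the polynomials \<open>p i j\<close> instead of \<open>E\<close>,
    because the two are known to agree only on the disc; this makes \<open>F\<close> polynomial at
    every \<open>z\<close>.\<close>
  define F where "F z = mat n n (\<lambda>(i, j). poly ([:if i = j then c else 0:] + [:cnj c:] * p i j) z)" for z
  have Fp: "mat_poly n F" unfolding mat_poly_def F_def[abs_def]
    by (intro exI[of _ "\<lambda>i j. [:if i = j then c else 0:] + [:cnj c:] * p i j"] allI refl)
  have Fc [simp]: "F z \<in> carrier_mat n n" for z by (simp add: F_def)
  have F: "F z = c \<cdot>\<^sub>m 1\<^sub>m n + cnj c \<cdot>\<^sub>m E z" if "cmod z \<le> 1" for z
  proof (rule eq_matI)
    fix i j assume "i < dim_row (c \<cdot>\<^sub>m 1\<^sub>m n + cnj c \<cdot>\<^sub>m E z)" "j < dim_col (c \<cdot>\<^sub>m 1\<^sub>m n + cnj c \<cdot>\<^sub>m E z)"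
    then have ij: "i < n" "j < n" by auto
    show "F z $$ (i, j) = (c \<cdot>\<^sub>m 1\<^sub>m n + cnj c \<cdot>\<^sub>m E z) $$ (i, j)"
      using ij p[OF ij that] by (auto simp: F_def)
  qed (auto simp: F_def)
  \<comment> \<open>By the degree bounds \<open>F\<close> is triangular for the weight
    \<open>e\<close> and constant where weights agree. So its determinant is constant, and
    invertibility at 0 spreads to all \<open>z\<close>.\<close>
  have detF: "det (F z) = det (F 0)" for z
  proof (rule det_weight_triangular_cong[OF Fc Fc])
    fix i j assume ij: "i < n" "j < n" and "e i < e j"
    then have "p i j = 0" "i \<noteq> j" using pd[OF ij] by auto
    then show "F z $$ (i, j) = 0 \<and> F 0 $$ (i, j) = 0" using ij by (simp add: F_def)
  next
    fix i j assume ij: "i < n" "j < n" and "e i = e j"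
    then have "degree (p i j) = 0" using pd[OF ij] by auto
    then obtain a where "p i j = [:a:]" by (rule degree_eq_zeroE)
    then show "F z $$ (i, j) = F 0 $$ (i, j)" using ij by (simp add: F_def)
  qed
  have detF0: "det (F 0) \<noteq> 0" using det0 F[of 0] by simp
  \<comment> \<open>The image of \<open>F\<close> on the other side of \<open>D\<close>: since
    \<open>F D = D Y\<close>, replacing \<open>P\<close> by \<open>P F\<close> is paid for by
    replacing \<open>N\<close> by \<open>Y^-1 N\<close>.\<close>
  define Y where "Y z = c \<cdot>\<^sub>m 1\<^sub>m n + cnj c \<cdot>\<^sub>m X z" for z
  have Yc [simp]: "Y z \<in> carrier_mat n n" for z by (simp add: Y_def)
  have Yr: "mat_rational n Y" unfolding Y_def[abs_def]
    by (intro mat_rational_add mat_rational_scale mat_rational_const disc_rational_const Xr) simp_all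
  have FD: "F z * ?D z = ?D z * Y (cnj z)" if z: "cmod z = 1" for z
  proof -
    have "F z * ?D z = c \<cdot>\<^sub>m ?D z + cnj c \<cdot>\<^sub>m (E z * ?D z)"
      using z by (simp add: F add_mult_distrib_mat[of _ n n _ _ n] mult_smult_assoc_mat[of _ n n _ n]
          left_mult_one_mat[of _ n n])
    also have "\<dots> = ?D z * Y (cnj z)"
      unfolding ED[OF z] Y_def
      by (simp add: mult_add_distrib_mat[of _ n n _ n] smult_distrib right_one)
    finally show ?thesis .
  qed
  have detY: "det (Y z) \<noteq> 0" if z: "cmod z \<le> 1" for z
  proof -
    have "det (Y z) = det (F 0)"
    proof (rule disc_rational_eqI[OF mat_rational_det[OF Yr] disc_rational_const _ z])
      fix w :: complex assume w: "cmod w = 1"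
      then have w0: "cnj w \<noteq> 0" by auto
      have "det (F (cnj w)) * det (?D (cnj w)) = det (?D (cnj w)) * det (Y w)"
        using arg_cong[OF FD[of "cnj w"], of det] w by (simp add: det_mult[of _ n])
      moreover have "det (?D (cnj w)) \<noteq> 0" using det_diag_pow[OF w0] w0 by simp
      ultimately show "det (Y w) = det (F 0)" using detF[of "cnj w"] by (simp add: mult.commute)
    qed
    then show ?thesis using detF0 by simp
  qed
  define Q where "Q z = P z * F z" for z
  define M where "M z = mat_inv (Y z) * N z" for z
  have "A z = Q z * ?D z * M (cnj z)" if z: "cmod z = 1" for z
  proof -
    have "Y (cnj z) * (mat_inv (Y (cnj z)) * N (cnj z)) = N (cnj z)"
      using z by (intro mat_eq_mult_cancel[of _ n] mat_inv(1) detY) auto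
    moreover have "Q z * ?D z * M (cnj z) = P z * (F z * ?D z) * M (cnj z)"
      by (simp add: Q_def assoc M_def)
    ultimately show ?thesis
      by (simp add: FD[OF z] assoc M_def A[OF z, folded n_def])
  qed
  moreover have "qtau d (Q (cnj z)) = Q z" if z: "cmod z \<le> 1" for z
  proof -
    \<comment> \<open>Here the pair of coefficients \<open>c\<close>, \<open>cnj c\<close> pays off:
      \<open>qtau\<close> exchanges them, and multiplication by \<open>E\<close> exchanges the two
      summands back.\<close>
    have "qtau d (F (cnj z)) = cnj c \<cdot>\<^sub>m 1\<^sub>m n + c \<cdot>\<^sub>m qtau d (E (cnj z))"
      using z by (simp add: F qtau_add[of _ d, folded n_def] qtau_smult[of _ d, folded n_def]
          qtau_one')
    moreover have "P' z = P z * E z"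
      using mat_eq_mult_cancel[OF Pc mat_inv_carrier[OF Pc] P'c mat_inv(1)[OF Pc detP[OF z]]]
      by (simp add: E_def)
    ultimately have "qtau d (Q (cnj z)) = P z * E z * (cnj c \<cdot>\<^sub>m 1\<^sub>m n + c \<cdot>\<^sub>m qtau d (E (cnj z)))"
      by (simp add: Q_def qtau_mult P'_def)
    also have "\<dots> = P z * (cnj c \<cdot>\<^sub>m E z + c \<cdot>\<^sub>m (E z * qtau d (E (cnj z))))"
      by (simp add: assoc mult_add_distrib_mat[of _ n n _ n] smult_distrib right_one)
    also have "cnj c \<cdot>\<^sub>m E z + c \<cdot>\<^sub>m (E z * qtau d (E (cnj z))) = F z"
      unfolding Etau[OF z] F[OF z] by (rule comm_add_mat) auto
    finally show ?thesis by (simp add: Q_def)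
  qed
  moreover have "mat_poly n Q" unfolding Q_def[abs_def] by (intro mat_poly_mult P Fp)
  moreover have "mat_rational n M" unfolding M_def[abs_def]
    by (intro mat_rational_mult mat_rational_inv Yr N detY)
  moreover have "det (Q z) \<noteq> 0" if "cmod z \<le> 1" for z
    using detP[OF that] detF[of z] detF0 by (simp add: Q_def det_mult[of _ n])
  moreover have "det (M z) \<noteq> 0" if z: "cmod z \<le> 1" for z
  proof -
    have "det (mat_inv (Y z)) \<noteq> 0"
      by (rule det_nonzero_if_mult_one(2)[OF Yc _ mat_inv(1)[OF Yc detY[OF z]]]) simp
    then show ?thesis using detN[OF z] by (simp add: M_def det_mult[of _ n])
  qed
  ultimately show ?thesis unfolding n_def by blast
qed

subsection \<open>The congruence core and the symmetry of the partial indices\<close>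

lemma powi_cnj_circle:
  assumes "cmod z = 1"
  shows "cnj z powi k = z powi (- k)"
proof -
  have "inverse z = cnj z"
    using assms complex_norm_square[of z] by (intro inverse_unique) simp
  then show ?thesis by (simp add: power_int_minus flip: power_int_inverse)
qed

definition congruence_core :: "complex mat \<Rightarrow> complex mat \<Rightarrow> complex mat"
  where "congruence_core Q A = mat_inv (Q) * A * cadj (mat_inv (Q))"

lemma congruence_core_carrier [simp]:
  "Q \<in> carrier_mat n n \<Longrightarrow> A \<in> carrier_mat n n \<Longrightarrow> congruence_core Q A \<in> carrier_mat n n"
  unfolding congruence_core_def by (intro mult_carrier_mat[of _ n n] cadj_carrier mat_inv_carrier)

lemma congruence_core:
  assumes Q: "Q \<in> carrier_mat n n" and A: "A \<in> carrier_mat n n" and det: "det (Q) \<noteq> 0"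
  shows "A = Q * congruence_core Q A * cadj (Q)"
    and "cadj (A) = - A \<Longrightarrow> cadj (congruence_core Q A) = - congruence_core Q A"
    and "det (A) \<noteq> 0 \<Longrightarrow> det (congruence_core Q A) \<noteq> 0"
proof -
  note assoc = assoc_mult_mat[of _ n n _ n _ n]
  have mc [simp]: "X * Y \<in> carrier_mat n n" if "X \<in> carrier_mat n n" "Y \<in> carrier_mat n n"
    for X Y :: "complex mat" using that by simp
  note [simp] = Q A
  have left_neg: "- X * Y = - (X * Y)" and right_neg: "X * - Y = - (X * Y)"
    if "X \<in> carrier_mat n n" "Y \<in> carrier_mat n n" for X Y :: "complex mat"
    using that by auto
  have inv: "cadj (mat_inv (Q)) * cadj (Q) = 1\<^sub>m n"
    using mat_inv(1)[OF Q det] by (simp flip: cadj_mult[of _ n])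
  have "Q * congruence_core Q A * cadj (Q) = Q * (mat_inv (Q) * (A * (cadj (mat_inv (Q)) * cadj (Q))))"
    by (simp add: congruence_core_def assoc)
  also have "\<dots> = A"
    unfolding inv by (simp add: right_mult_one_mat[of _ n n] mat_eq_mult_cancel[OF Q _ A mat_inv(1)[OF Q det]])
  finally show eq: "A = Q * congruence_core Q A * cadj (Q)" by simp
  show "cadj (congruence_core Q A) = - congruence_core Q A" if "cadj (A) = - A"
  proof -
    have "cadj (congruence_core Q A) = mat_inv (Q) * (cadj (A) * cadj (mat_inv (Q)))"
      by (simp add: congruence_core_def cadj_mult[of _ n] cadj_cadj)
    also have "\<dots> = - congruence_core Q A"
      unfolding that by (simp add: congruence_core_def assoc right_neg left_neg)
    finally show ?thesis .
  qed
  show "det (congruence_core Q A) \<noteq> 0" if "det (A) \<noteq> 0"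
  proof
    assume "det (congruence_core Q A) = 0"
    then have "det (Q * congruence_core Q A * cadj Q) = 0" by (simp add: det_mult[of _ n])
    with that eq show False by metis
  qed
qed

text \<open>Inserting the factorization turns the core into \<open>D G\<close> with \<open>G\<close>
  regular outside the disc, so powers of \<open>z\<close> in row \<open>i\<close> stay at or below
  \<open>e i\<close>. Skewness reads entry \<open>(i, j)\<close> off entry \<open>(j, i)\<close>,
  giving powers at or above \<open>- e j\<close>. The Liouville argument combines the two
  descriptions.\<close>

theorem congruence_core_laurent:
  fixes e :: "nat \<Rightarrow> int"
  assumes Q: "mat_rational n Q" and detQ: "\<And>z. cmod z \<le> 1 \<Longrightarrow> det (Q z) \<noteq> 0"
    and M: "mat_rational n M"
    and A: "\<And>z. cmod z = 1 \<Longrightarrow> A z = Q z * diag_pow n e z * M (cnj z)"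
    and skew: "\<And>z. cmod z = 1 \<Longrightarrow> cadj (A z) = - A z"
  obtains p where
    "\<And>i j z. i < n \<Longrightarrow> j < n \<Longrightarrow> cmod z = 1 \<Longrightarrow> congruence_core (Q z) (A z) $$ (i, j) = z powi (- e j) * poly (p i j) z"
    "\<And>i j. i < n \<Longrightarrow> j < n \<Longrightarrow> p i j = 0 \<or> int (degree (p i j)) \<le> e i + e j"
proof -
  note assoc = assoc_mult_mat[of _ n n _ n _ n]
  have mc [simp]: "X * Y \<in> carrier_mat n n" if "X \<in> carrier_mat n n" "Y \<in> carrier_mat n n"
    for X Y :: "complex mat" using that by simp
  have Qc [simp]: "Q z \<in> carrier_mat n n" and Mc [simp]: "M z \<in> carrier_mat n n" for z
    using mat_rational_carrier Q M by auto
  define G where "G w = M w * cadj (mat_inv (Q (cnj w)))" for w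
  have Gc [simp]: "G w \<in> carrier_mat n n" for w by (simp add: G_def)
  have Gr: "mat_rational n G" unfolding G_def[abs_def]
    by (intro mat_rational_mult M mat_rational_cadj[of n "\<lambda>z. mat_inv (Q z)"] mat_rational_inv Q detQ)
  have B: "congruence_core (Q z) (A z) $$ (i, j) = z powi e i * G (cnj z) $$ (i, j)"
    if z: "cmod z = 1" and ij: "i < n" "j < n" for z i j
  proof -
    have "congruence_core (Q z) (A z) = mat_inv (Q z) * (Q z * (diag_pow n e z * G (cnj z)))"
      by (simp add: congruence_core_def A[OF z] assoc G_def)
    also have "\<dots> = diag_pow n e z * G (cnj z)"
      using z by (intro mat_eq_mult_cancel[of _ n] mat_inv(2) detQ) auto
    finally show ?thesis by (simp only: diag_pow_mult_entry[OF Gc ij])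
  qed
  define f where "f i j z = - cnj (G (cnj z) $$ (j, i))" for i j z
  have Bf: "congruence_core (Q z) (A z) $$ (i, j) = z powi (- e j) * f i j z"
    if z: "cmod z = 1" and ij: "i < n" "j < n" for z i j
  proof -
    have Ac: "A z \<in> carrier_mat n n" by (simp add: A[OF z])
    have Bc: "congruence_core (Q z) (A z) \<in> carrier_mat n n" by (intro congruence_core_carrier Qc Ac)
    have "cadj (congruence_core (Q z) (A z)) $$ (j, i) = (- congruence_core (Q z) (A z)) $$ (j, i)"
      using congruence_core(2)[OF Qc Ac _ skew[OF z]] detQ[of z] z by simp
    then have "congruence_core (Q z) (A z) $$ (i, j) = - cnj (congruence_core (Q z) (A z) $$ (j, i))"
      using ij Bc by (simp add: complex_eq_iff)
    then show ?thesis by (simp add: B[OF z ij(2,1)] f_def powi_cnj_circle[OF z])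
  qed
  have "\<exists>p. (\<forall>z. cmod z \<le> 1 \<longrightarrow> f i j z = poly p z) \<and> (p = 0 \<or> int (degree p) \<le> e i + e j)"
    if ij: "i < n" "j < n" for i j
  proof (rule disc_rational_liouville[OF _ mat_rational_entry[OF Gr ij]])
    show "disc_rational (f i j)" unfolding f_def[abs_def]
      by (intro disc_rational_uminus disc_rational_cnj[of "\<lambda>z. G z $$ (j, i)"] mat_rational_entry[OF Gr] ij)
    fix z :: complex assume z: "cmod z = 1"
    then have z0: "z \<noteq> 0" by auto
    show "f i j z = z powi (e i + e j) * G (cnj z) $$ (i, j)"
      using B[OF z ij] z0 unfolding Bf[OF z ij]
      by (simp add: power_int_add power_int_minus field_simps)
  qed
  then obtain p where "\<And>i j z. i < n \<Longrightarrow> j < n \<Longrightarrow> cmod z \<le> 1 \<Longrightarrow> f i j z = poly (p i j) z"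
    and pd: "\<And>i j. i < n \<Longrightarrow> j < n \<Longrightarrow> p i j = 0 \<or> int (degree (p i j)) \<le> e i + e j"
    by metis
  then have "congruence_core (Q z) (A z) $$ (i, j) = z powi (- e j) * poly (p i j) z"
    if "i < n" "j < n" "cmod z = 1" for i j z
    using that Bf by simp
  then show thesis using pd by (rule that)
qed

text \<open>In even dimension \<open>det (- A) = det A\<close>, so \<open>det A\<close> is real on
  the circle. Comparing its factorization with the conjugate one shows that \<open>f\<close> is a
  polynomial of degree at most \<open>- 2 * s\<close>. As it does not vanish at 0, this bound cannot
  be negative.\<close>

lemma skew_index_sum_nonpos:
  fixes e :: "nat \<Rightarrow> int"
  assumes Q: "mat_rational n Q" and detQ: "\<And>z. cmod z \<le> 1 \<Longrightarrow> det (Q z) \<noteq> 0"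
    and M: "mat_rational n M" and detM: "\<And>z. cmod z \<le> 1 \<Longrightarrow> det (M z) \<noteq> 0"
    and A: "\<And>z. cmod z = 1 \<Longrightarrow> A z = Q z * diag_pow n e z * M (cnj z)"
    and skew: "\<And>z. cmod z = 1 \<Longrightarrow> cadj (A z) = - A z" and "even n"
  shows "(\<Sum>i<n. e i) \<le> 0"
proof -
  define s where "s = (\<Sum>i<n. e i)"
  define q where "q z = det (Q z)" for z
  define m where "m z = det (M z)" for z
  have qr: "disc_rational q" and mr: "disc_rational m"
    unfolding q_def[abs_def] m_def[abs_def] by (rule mat_rational_det[OF Q], rule mat_rational_det[OF M])
  have qm: "q z \<noteq> 0" "m z \<noteq> 0" if "cmod z \<le> 1" for z
    using that detQ detM by (auto simp: q_def m_def)
  define f where "f z = q z * inverse (cnj (m (cnj z)))" for z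
  define g where "g z = cnj (q (cnj z)) * inverse (m z)" for z
  have "\<exists>p. (\<forall>z. cmod z \<le> 1 \<longrightarrow> f z = poly p z) \<and> (p = 0 \<or> int (degree p) \<le> - 2 * s)"
  proof (rule disc_rational_liouville)
    show "disc_rational f" unfolding f_def[abs_def]
      using qm(2) by (intro disc_rational_mult disc_rational_inverse disc_rational_cnj qr mr) auto
    show "disc_rational g" unfolding g_def[abs_def]
      using qm(2) by (intro disc_rational_mult disc_rational_inverse disc_rational_cnj qr mr) auto
    fix z :: complex assume z: "cmod z = 1"
    then have z0: "z \<noteq> 0" by auto
    have c: "Q z \<in> carrier_mat n n" "M (cnj z) \<in> carrier_mat n n"
      using mat_rational_carrier Q M by auto
    have Ac: "A z \<in> carrier_mat n n" unfolding A[OF z] by (intro mult_carrier_mat[of _ n n] c diag_pow_carrier)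
    have detA: "det (A z) = q z * z powi s * m (cnj z)"
      unfolding A[OF z] q_def m_def s_def
      by (simp add: det_mult[of _ n] c mult_carrier_mat[of _ n n] det_diag_pow[OF z0])
    have "- A z = (- 1) \<cdot>\<^sub>m A z" by (rule eq_matI) auto
    then have "cnj (det (A z)) = det (A z)"
      using det_cadj[OF Ac] Ac \<open>even n\<close> by (simp add: skew[OF z])
    then have "q z * z powi s * m (cnj z) = cnj (q z) * z powi (- s) * cnj (m (cnj z))"
      unfolding detA by (simp add: powi_cnj_circle[OF z])
    moreover have "m (cnj z) \<noteq> 0" using qm z by simp
    ultimately show "f z = z powi (- 2 * s) * g (cnj z)"
      using z0 power_int_add[of z s s] unfolding f_def g_def
      by (simp add: power_int_minus field_simps)
  qed
  then obtain p where "\<forall>z. cmod z \<le> 1 \<longrightarrow> f z = poly p z" and "p = 0 \<or> int (degree p) \<le> - 2 * s"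
    by blast
  then have p: "f 0 = poly p 0" "p = 0 \<or> int (degree p) \<le> - 2 * s" by simp_all
  have "f 0 \<noteq> 0" using qm[of 0] by (simp add: f_def)
  then show ?thesis using p unfolding s_def by auto
qed

text \<open>A nonzero entry \<open>(i, \<pi> i)\<close> of the core at the single point 1 forces
  \<open>e i + e (\<pi> i)\<close> to be nonnegative. Over a permutation these numbers add up to
  twice the sum of \<open>e\<close>, which is nonpositive; so each of them is 0.\<close>

theorem skew_index_pairing:
  fixes e :: "nat \<Rightarrow> int"
  assumes Q: "mat_rational n Q" and detQ: "\<And>z. cmod z \<le> 1 \<Longrightarrow> det (Q z) \<noteq> 0"
    and M: "mat_rational n M" and detM: "\<And>z. cmod z \<le> 1 \<Longrightarrow> det (M z) \<noteq> 0"
    and A: "\<And>z. cmod z = 1 \<Longrightarrow> A z = Q z * diag_pow n e z * M (cnj z)"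
    and skew: "\<And>z. cmod z = 1 \<Longrightarrow> cadj (A z) = - A z" and "even n"
  obtains \<pi> where "\<pi> permutes {0..<n}" "\<And>i. i < n \<Longrightarrow> e (\<pi> i) = - e i"
proof -
  obtain p where
    p: "\<And>i j z. i < n \<Longrightarrow> j < n \<Longrightarrow> cmod z = 1 \<Longrightarrow> congruence_core (Q z) (A z) $$ (i, j) = z powi (- e j) * poly (p i j) z"
    and pd: "\<And>i j. i < n \<Longrightarrow> j < n \<Longrightarrow> p i j = 0 \<or> int (degree (p i j)) \<le> e i + e j"
    using congruence_core_laurent[OF Q detQ M A skew] by metis
  have c: "Q 1 \<in> carrier_mat n n" "M 1 \<in> carrier_mat n n"
    using mat_rational_carrier Q M by auto
  have A1: "A 1 = Q 1 * diag_pow n e 1 * M 1" using A[of 1] by simp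
  have Ac: "A 1 \<in> carrier_mat n n" unfolding A1 by (intro mult_carrier_mat[of _ n n] c diag_pow_carrier)
  have "det (A 1) \<noteq> 0"
    unfolding A1 using detQ[of 1] detM[of 1]
    by (simp add: det_mult[of _ n] c mult_carrier_mat[of _ n n] det_diag_pow)
  then have "det (congruence_core (Q 1) (A 1)) \<noteq> 0"
    using detQ[of 1] by (intro congruence_core(3)[OF c(1) Ac]) auto
  then obtain \<pi> where \<pi>: "\<pi> permutes {0..<n}"
    and nz: "\<And>i. i < n \<Longrightarrow> congruence_core (Q 1) (A 1) $$ (i, \<pi> i) \<noteq> 0"
    using det_nonzero_transversal[OF congruence_core_carrier[OF c(1) Ac]] by metis
  have nonneg: "0 \<le> e i + e (\<pi> i)" if i: "i \<in> {0..<n}" for i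
  proof -
    have "\<pi> i < n" "i < n" using permutes_in_image[OF \<pi>, of i] i by auto
    then show ?thesis using nz[of i] p[of i "\<pi> i" 1] pd[of i "\<pi> i"] by fastforce
  qed
  have "(\<Sum>i = 0..<n. e (\<pi> i)) = (\<Sum>i = 0..<n. e i)"
    using sum.permute[OF \<pi>, of e] by (simp add: comp_def)
  then have "(\<Sum>i = 0..<n. e i + e (\<pi> i)) \<le> 0"
    using skew_index_sum_nonpos[OF assms] by (simp add: sum.distrib atLeast0LessThan)
  moreover have "(\<Sum>i = 0..<n. e i + e (\<pi> i)) \<ge> 0" using nonneg by (rule sum_nonneg)
  ultimately have "\<forall>i\<in>{0..<n}. e i + e (\<pi> i) = 0"
    using sum_nonneg_eq_0_iff[of "{0..<n}" "\<lambda>i. e i + e (\<pi> i)"] nonneg by simp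
  then show thesis using \<pi> by (intro that[of \<pi>]) (auto simp: eq_neg_iff_add_eq_0 add.commute)
qed

text \<open>Negation permutes the doubled list of indices. Its reversal and its negation are
  therefore increasing lists with the same multiset, hence equal.\<close>

lemma sorted_index_antisymmetric:
  fixes K :: "int list"
  assumes len: "length K = d" and sorted: "sorted_wrt (\<ge>) K"
    and \<pi>: "\<pi> permutes {0..<2 * d}"
    and neg: "\<And>i. i < 2 * d \<Longrightarrow> K ! (\<pi> i div 2) = - K ! (i div 2)"
    and m: "m < d"
  shows "K ! (d - 1 - m) = - K ! m"
proof -
  define f where "f i = K ! (i div 2)" for i
  have anti: "f j \<le> f i" if "i \<le> j" "j < 2 * d" for i j
  proof (cases "i div 2 = j div 2")
    case False
    then have "i div 2 < j div 2" using div_le_mono[OF that(1), of 2] by simp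
    moreover have "j div 2 < d" using that(2) by simp
    ultimately show ?thesis using sorted len unfolding sorted_wrt_iff_nth_less f_def by blast
  qed (simp add: f_def)
  have "sorted (rev (map f [0..<2 * d]))"
    unfolding sorted_iff_nth_mono by (auto simp: rev_nth intro!: anti)
  moreover have "sorted (map (\<lambda>i. - f i) [0..<2 * d])"
    unfolding sorted_iff_nth_mono by (auto intro!: anti)
  moreover have "mset (rev (map f [0..<2 * d])) = mset (map (\<lambda>i. - f i) [0..<2 * d])"
  proof -
    have "image_mset \<pi> (mset_set {0..<2 * d}) = mset_set {0..<2 * d}"
      using image_mset_mset_set[of \<pi> "{0..<2 * d}"] permutes_inj_on[OF \<pi>] permutes_image[OF \<pi>] by simp
    then have "image_mset f (mset_set {0..<2 * d}) = image_mset (\<lambda>i. f (\<pi> i)) (mset_set {0..<2 * d})"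
      by (metis (no_types, lifting) image_mset.compositionality comp_def image_mset_cong)
    also have "\<dots> = image_mset (\<lambda>i. - f i) (mset_set {0..<2 * d})"
      using neg by (intro image_mset_cong) (auto simp: f_def)
    finally show ?thesis by simp
  qed
  ultimately have "rev (map f [0..<2 * d]) = map (\<lambda>i. - f i) [0..<2 * d]"
    by (metis properties_for_sort)
  \<comment> \<open>Reversal takes position \<open>2 * m\<close> to
    \<open>2 * d - 1 - 2 * m\<close>, the second slot of block \<open>d - 1 - m\<close>.\<close>
  then have "rev (map f [0..<2 * d]) ! (2 * m) = map (\<lambda>i. - f i) [0..<2 * d] ! (2 * m)" by simp
  then have "f (2 * d - Suc (2 * m)) = - f (2 * m)" using m by (simp add: rev_nth)
  moreover have "(2 * d - Suc (2 * m)) div 2 = d - 1 - m" using m by linarith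
  ultimately show ?thesis by (simp add: f_def)
qed

subsection \<open>Normal form of the core\<close>

text \<open>An entry of the 2 x 2 matrix of \<open>x\<close>. Only parities count, so indices of the
  large matrix can be inserted without reduction.\<close>

definition qent :: "quat \<Rightarrow> nat \<Rightarrow> nat \<Rightarrow> complex" where
  "qent x i j = (if even i then (if even j then qa x else qb x)
    else (if even j then - cnj (qb x) else cnj (qa x)))"

lemma qent_swap: "qent x i j = qsgn i * qsgn j * cnj (qent x (qsw i) (qsw j))"
  by (simp add: qent_def qsgn_def qsw_def)

lemma qent_mult: "qent (x * y) i j = qent x i 0 * qent y 0 j + qent x i 1 * qent y 1 j"
  by (simp add: qent_def)

lemma qent_qcnj: "qent (qcnj x) i j = cnj (qent x j i)"
  by (simp add: qent_def)

lemma qent_sum: "qent (\<Sum>m\<in>I. f m) i j = (\<Sum>m\<in>I. qent (f m) i j)"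
  by (simp add: qent_def sum_negf)

lemma qent_k_sandwich:
  "qent (x * quat_k * qcnj y) i j
    = qent x i 0 * \<i> * cnj (qent y j 0) - qent x i 1 * \<i> * cnj (qent y j 1)"
  unfolding qent_mult qent_qcnj by (simp add: qent_def)

lemma qent_mod_2: "qent x i (2 * m) = qent x i 0" "qent x i (Suc (2 * m)) = qent x i 1"
  by (simp_all add: qent_def)

lemma sum_pairs: "(\<Sum>l<2 * d. f l) = (\<Sum>m<d. f (2 * m) + f (Suc (2 * m)))"
  by (induction d) (simp_all add: add.assoc)

text \<open>Lagrange diagonalization in complex coordinates: \<open>T\<close> reads a quaternion off
  the first row of each block, and \<open>k\<close> turns into the diagonal entries
  \<open>\<i> * qsgn l\<close>. The set \<open>I\<close> will be that of the blocks of index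
  0.\<close>

theorem quaternionic_skew_factor:
  fixes S :: "nat \<Rightarrow> nat \<Rightarrow> complex"
  assumes I: "I \<subseteq> {..<d}"
    and skew: "\<And>i j. i div 2 \<in> I \<Longrightarrow> j div 2 \<in> I \<Longrightarrow> S j i = - cnj (S i j)"
    and quat: "\<And>i j. i div 2 \<in> I \<Longrightarrow> j div 2 \<in> I \<Longrightarrow> S i j = qsgn i * qsgn j * cnj (S (qsw i) (qsw j))"
  shows "\<exists>r. (\<forall>i j. r i j = qsgn i * qsgn j * cnj (r (qsw i) (qsw j))) \<and>
    (\<forall>i j. i div 2 \<in> I \<longrightarrow> j div 2 \<in> I \<longrightarrow>
      S i j = (\<Sum>l<2 * d. if l div 2 \<in> I then r i l * (\<i> * qsgn l) * cnj (r j l) else 0))"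
proof -
  define T where "T m m' = Quat (S (2 * m) (2 * m')) (S (2 * m) (Suc (2 * m')))" for m m'
  have ST: "S i j = qent (T (i div 2) (j div 2)) i j" if ij: "i div 2 \<in> I" "j div 2 \<in> I" for i j
  proof -
    have sw: "even l \<Longrightarrow> qsw l = Suc (2 * (l div 2))" "odd l \<Longrightarrow> qsw l = 2 * (l div 2)" for l
      unfolding qsw_def by presburger+
    show ?thesis
    proof (cases "even i")
      case True
      then show ?thesis by (cases "even j") (simp_all add: qent_def T_def)
    next
      case False
      then show ?thesis
        unfolding quat[OF ij] by (cases "even j") (simp_all add: qent_def T_def sw qsgn_def)
    qed
  qed
  have "skew_on I T"
    unfolding skew_on_def
  proof (intro ballI quat_eqI)
    fix m m' assume m: "m \<in> I" "m' \<in> I"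
    show "qa (T m' m) = qa (- qcnj (T m m'))"
      using skew[of "2 * m" "2 * m'"] m by (simp add: T_def)
    have "S (2 * m') (Suc (2 * m)) = - cnj (S (Suc (2 * m)) (2 * m'))"
      using skew[of "Suc (2 * m)" "2 * m'"] m by simp
    also have "S (Suc (2 * m)) (2 * m') = - cnj (S (2 * m) (Suc (2 * m')))"
      using quat[of "Suc (2 * m)" "2 * m'"] m by (simp add: qsgn_def qsw_def)
    finally show "qb (T m' m) = qb (- qcnj (T m m'))" by (simp add: T_def)
  qed
  moreover have fin: "finite I" using I finite_subset by blast
  ultimately obtain q where q: "k_factor_on I T q" using skew_k_factor by blast
  define r where "r i j = qent (q (i div 2) (j div 2)) i j" for i j
  have "r i j = qsgn i * qsgn j * cnj (r (qsw i) (qsw j))" for i j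
    unfolding r_def qsw_div_2 by (rule qent_swap)
  moreover have "S i j = (\<Sum>l<2 * d. if l div 2 \<in> I then r i l * (\<i> * qsgn l) * cnj (r j l) else 0)"
    if ij: "i div 2 \<in> I" "j div 2 \<in> I" for i j
  proof -
    have "S i j = (\<Sum>m\<in>I. qent (q (i div 2) m * quat_k * qcnj (q (j div 2) m)) i j)"
      using q ij unfolding k_factor_on_def ST[OF ij] by (simp flip: qent_sum)
    also have "\<dots> = (\<Sum>m\<in>I. r i (2 * m) * \<i> * cnj (r j (2 * m)) - r i (Suc (2 * m)) * \<i> * cnj (r j (Suc (2 * m))))"
      unfolding qent_k_sandwich r_def by (simp add: qent_mod_2)
    also have "\<dots> = (\<Sum>m<d. if m \<in> I then r i (2 * m) * \<i> * cnj (r j (2 * m)) - r i (Suc (2 * m)) * \<i> * cnj (r j (Suc (2 * m))) else 0)"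
      using I by (intro sum.mono_neutral_cong_left) auto
    also have "\<dots> = (\<Sum>l<2 * d. if l div 2 \<in> I then r i l * (\<i> * qsgn l) * cnj (r j l) else 0)"
      unfolding sum_pairs by (intro sum.cong) (auto simp: qsgn_def)
    finally show ?thesis .
  qed
  ultimately show ?thesis by blast
qed

section \<open>Block reversal and the entries of \<open>D4\<close>\<close>

lemma eq_iff_div_mod_2: "(i :: nat) = j \<longleftrightarrow> i div 2 = j div 2 \<and> i mod 2 = j mod 2"
proof
  assume "i div 2 = j div 2 \<and> i mod 2 = j mod 2"
  then have "2 * (i div 2) + i mod 2 = 2 * (j div 2) + j mod 2" by simp
  then show "i = j" by simp
qed simp

definition bar :: "nat \<Rightarrow> nat \<Rightarrow> nat" where
  "bar d i = 2 * (d - 1 - i div 2) + i mod 2"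

lemma bar:
  assumes "i < 2 * d"
  shows bar_div_2: "bar d i div 2 = d - 1 - i div 2"
    and bar_less: "bar d i < 2 * d" and bar_bar: "bar d (bar d i) = i"
    and even_bar: "even (bar d i) = even i" and bar_qsw: "bar d (qsw i) = qsw (bar d i)"
proof -
  show d: "bar d i div 2 = d - 1 - i div 2" by (simp add: bar_def)
  have i: "i div 2 < d" using assms by simp
  show "bar d i < 2 * d" unfolding bar_def using i by linarith
  have "bar d i mod 2 = i mod 2" by (simp add: bar_def)
  then have "bar d (bar d i) = 2 * (d - 1 - (d - 1 - i div 2)) + i mod 2" using d by (simp add: bar_def)
  also have "d - 1 - (d - 1 - i div 2) = i div 2" using i by simp
  finally show "bar d (bar d i) = i" by simp
  show e: "even (bar d i) = even i" by (simp add: bar_def)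
  show "bar d (qsw i) = qsw (bar d i)"
    using e by (cases "even i") (auto simp: bar_def qsw_def elim!: evenE oddE)
qed

text \<open>\<open>D4\<close> has one nonzero entry in each column. Although its first sum runs over
  positive indices, the second summand in it fills the columns of negative index: by antisymmetry
  \<open>- (K ! m)\<close> is the index of the column block \<open>d - 1 - m\<close>.\<close>

lemma D4_entry:
  assumes anti: "\<And>m. m < d \<Longrightarrow> K ! (d - 1 - m) = - K ! m" and ij: "i < 2 * d" "j < 2 * d"
  shows "D4 d K z $$ (i, j) = (if K ! (j div 2) = 0 then (if i = j then \<i> * qsgn j else 0)
    else if i = bar d j then (if K ! (j div 2) > 0 then - (z powi (K ! (j div 2))) else z powi (K ! (j div 2)))
    else 0)"
proof -
  have i2: "i div 2 < d" and j2: "j div 2 < d" using ij by auto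
  have blk1: "blk_entry (1\<^sub>m 2) m m' i j = (if i div 2 = m \<and> j div 2 = m' \<and> i mod 2 = j mod 2 then 1 else 0)" for m m'
    by (simp add: blk_entry_def)
  have blkk: "blk_entry qk m m i j = (if m = j div 2 then (if i = j then \<i> * qsgn j else 0) else 0)" for m
  proof (cases "i div 2 = j div 2")
    case True
    have eq: "i = j \<longleftrightarrow> i mod 2 = j mod 2" using True eq_iff_div_mod_2 by blast
    have "j mod 2 = (if even j then 0 else 1)" by presburger
    then show ?thesis
      using True unfolding eq by (simp add: blk_entry_def qk_def qsgn_def)
  qed (auto simp: blk_entry_def)
  have ibar: "i = bar d j \<longleftrightarrow> i div 2 = d - 1 - j div 2 \<and> i mod 2 = j mod 2"
  proof -
    have "i = 2 * a + j mod 2 \<longleftrightarrow> i div 2 = a \<and> i mod 2 = j mod 2" for a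
      by (subst eq_iff_div_mod_2) simp
    then show ?thesis unfolding bar_def .
  qed
  have "(\<Sum>m\<in>{m. m < d \<and> K ! m > 0}. z powi (K ! m) * blk_entry (1\<^sub>m 2) (d - 1 - m) m i j)
      = (\<Sum>m\<in>{m. m < d \<and> K ! m > 0}. if m = j div 2 then (if i = bar d j then z powi (K ! (j div 2)) else 0) else 0)"
    by (intro sum.cong) (auto simp: blk1 ibar)
  also have "\<dots> = (if K ! (j div 2) > 0 \<and> i = bar d j then z powi (K ! (j div 2)) else 0)"
    using j2 by (simp add: sum.delta')
  finally have s1: "(\<Sum>m\<in>{m. m < d \<and> K ! m > 0}. z powi (K ! m) * blk_entry (1\<^sub>m 2) (d - 1 - m) m i j)
      = (if K ! (j div 2) > 0 \<and> i = bar d j then z powi (K ! (j div 2)) else 0)" .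
  have dm: "d - 1 - j div 2 < d" "\<And>m. m < d \<Longrightarrow> j div 2 = d - 1 - m \<longleftrightarrow> m = d - 1 - j div 2" using j2 by auto
  have "(\<Sum>m\<in>{m. m < d \<and> K ! m > 0}. z powi (- (K ! m)) * blk_entry (1\<^sub>m 2) m (d - 1 - m) i j)
      = (\<Sum>m\<in>{m. m < d \<and> K ! m > 0}. if m = d - 1 - j div 2 then (if i = bar d j then z powi (K ! (j div 2)) else 0) else 0)"
  proof (intro sum.cong refl)
    fix m assume "m \<in> {m. m < d \<and> K ! m > 0}"
    then have m: "m < d" by simp
    show "z powi (- (K ! m)) * blk_entry (1\<^sub>m 2) m (d - 1 - m) i j
      = (if m = d - 1 - j div 2 then (if i = bar d j then z powi (K ! (j div 2)) else 0) else 0)"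
      using dm(2)[OF m] anti[OF j2] ibar by (auto simp: blk1)
  qed
  also have "\<dots> = (if K ! (j div 2) < 0 \<and> i = bar d j then z powi (K ! (j div 2)) else 0)"
    using dm(1) anti[OF j2] by (simp add: sum.delta')
  finally have s2: "(\<Sum>m\<in>{m. m < d \<and> K ! m > 0}. z powi (- (K ! m)) * blk_entry (1\<^sub>m 2) m (d - 1 - m) i j)
      = (if K ! (j div 2) < 0 \<and> i = bar d j then z powi (K ! (j div 2)) else 0)" .
  have s3: "(\<Sum>m\<in>{m. m < d \<and> K ! m = 0}. blk_entry qk m m i j) = (if K ! (j div 2) = 0 then (if i = j then \<i> * qsgn j else 0) else 0)"
    unfolding blkk using j2 by (simp add: sum.delta')
  have "D4 d K z $$ (i, j) = - ((if K ! (j div 2) > 0 \<and> i = bar d j then z powi (K ! (j div 2)) else 0)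
      - (if K ! (j div 2) < 0 \<and> i = bar d j then z powi (K ! (j div 2)) else 0))
      + (if K ! (j div 2) = 0 then (if i = j then \<i> * qsgn j else 0) else 0)"
    unfolding D4_def using ij by (simp only: index_mat(1) prod.case sum_subtractf s1 s2 s3)
  then show ?thesis by auto
qed

definition D4_coeff :: "int list \<Rightarrow> complex \<Rightarrow> nat \<Rightarrow> complex" where
  "D4_coeff K z l = (if K ! (l div 2) = 0 then \<i> * qsgn l
    else if K ! (l div 2) > 0 then - (z powi (K ! (l div 2))) else z powi (K ! (l div 2)))"

lemma mult_D4_entry:
  assumes anti: "\<And>m. m < d \<Longrightarrow> K ! (d - 1 - m) = - K ! m"
    and X: "X \<in> carrier_mat (2 * d) (2 * d)" and il: "i < 2 * d" "l < 2 * d"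
  shows "(X * D4 d K z) $$ (i, l)
    = X $$ (i, if K ! (l div 2) = 0 then l else bar d l) * D4_coeff K z l"
proof -
  define t where "t = (if K ! (l div 2) = 0 then l else bar d l)"
  have t: "t < 2 * d" using il bar_less by (simp add: t_def)
  have D: "D4 d K z \<in> carrier_mat (2 * d) (2 * d)" by (simp add: D4_def)
  have "(X * D4 d K z) $$ (i, l) = (\<Sum>j<2*d. if j = t then X $$ (i, t) * D4_coeff K z l else 0)"
    unfolding mat_mult_entry[OF X D il]
    using il by (intro sum.cong refl) (simp add: D4_entry[OF anti] t_def D4_coeff_def)
  then show ?thesis using t unfolding t_def by simp
qed

text \<open>Outside the blocks of index 0, \<open>B\<close> is \<open>W\<close> minus the adjoint of
  \<open>W\<close>, where \<open>W\<close> keeps weighted columns of \<open>B\<close> of negative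
  index. In \<open>V\<close> the columns of negative index are unit vectors, those of positive index
  hold the polynomial parts of \<open>W\<close>; \<open>D4\<close> couples the two kinds and
  restores the powers of \<open>z\<close>.\<close>

theorem skew_laurent_normal_form:
  fixes K :: "int list" and p :: "nat \<Rightarrow> nat \<Rightarrow> complex poly"
  assumes anti: "\<And>m. m < d \<Longrightarrow> K ! (d - 1 - m) = - K ! m"
    and Bc: "\<And>z. cmod z = 1 \<Longrightarrow> B z \<in> carrier_mat (2 * d) (2 * d)"
    and Bp: "\<And>i j z. i < 2 * d \<Longrightarrow> j < 2 * d \<Longrightarrow> cmod z = 1 \<Longrightarrow>
      B z $$ (i, j) = z powi (K ! (j div 2)) * poly (p i j) z"
    and pd: "\<And>i j. i < 2 * d \<Longrightarrow> j < 2 * d \<Longrightarrow>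
      p i j = 0 \<or> int (degree (p i j)) \<le> - (K ! (i div 2) + K ! (j div 2))"
    and skew: "\<And>z. cmod z = 1 \<Longrightarrow> cadj (B z) = - B z"
    and quat: "\<And>z. cmod z = 1 \<Longrightarrow> qtau d (B (cnj z)) = B z"
  shows "\<exists>V. mat_poly (2 * d) V \<and> (\<forall>z. qtau d (V (cnj z)) = V z) \<and>
    (\<forall>z w. det (V z) = det (V w)) \<and>
    (\<forall>z. cmod z = 1 \<longrightarrow> B z = V z * D4 d K z * cadj (V z))"
proof -
  define n where "n = 2 * d"
  define k where "k i = K ! (i div 2)" for i
  note Bc = Bc[folded n_def] and Bp = Bp[folded n_def k_def] and pd = pd[folded n_def k_def]
  have bar_less: "bar d i < n" and bar_bar: "bar d (bar d i) = i" and k_bar: "k (bar d i) = - k i"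
    and bar_qsw: "bar d (qsw i) = qsw (bar d i)" and qsw_less: "qsw i < n"
    and qsgn_bar: "qsgn (bar d i) = qsgn i" if "i < n" for i
  proof -
    have i: "i < 2 * d" using that by (simp add: n_def)
    then have "i div 2 < d" by simp
    from anti[OF this] show "k (bar d i) = - k i" by (simp add: k_def bar_div_2[OF i])
    show "bar d i < n" "bar d (bar d i) = i" "bar d (qsw i) = qsw (bar d i)" "qsw i < n"
      using bar_less[OF i] bar_bar[OF i] bar_qsw[OF i] qsw_less[OF i] by (simp_all add: n_def)
    show "qsgn (bar d i) = qsgn i" using even_bar[OF i] by (simp add: qsgn_def)
  qed
  have k_qsw [simp]: "k (qsw i) = k i" for i by (simp add: k_def)
  have Bskew: "B z $$ (i, j) = - cnj (B z $$ (j, i))" if z: "cmod z = 1" and ij: "i < n" "j < n" for z i j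
  proof -
    have "cadj (B z) $$ (j, i) = (- B z) $$ (j, i)" unfolding skew[OF z] ..
    then show ?thesis using ij Bc[OF z] by (simp add: complex_eq_iff)
  qed
  have p_tau: "poly (p i j) z = qsgn i * qsgn j * cnj (poly (p (qsw i) (qsw j)) (cnj z))"
    if ij: "i < n" "j < n" for i j z
  proof -
    have "p i j = [:qsgn i * qsgn j:] * map_poly cnj (p (qsw i) (qsw j))"
    proof (rule poly_eq_on_circle)
      fix z :: complex assume z: "cmod z = 1"
      then have z0: "z \<noteq> 0" by auto
      have "B z $$ (i, j) = qsgn i * qsgn j * cnj (B (cnj z) $$ (qsw i, qsw j))"
        using arg_cong[OF quat[OF z], of "\<lambda>M. M $$ (i, j)"] ij by (simp add: n_def)
      then have "z powi k j * poly (p i j) z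
          = z powi k j * (qsgn i * qsgn j * cnj (poly (p (qsw i) (qsw j)) (cnj z)))"
        using z ij by (simp add: Bp qsw_less mult_ac)
      then show "poly (p i j) z = poly ([:qsgn i * qsgn j:] * map_poly cnj (p (qsw i) (qsw j))) z"
        using z0 by simp
    qed
    then show ?thesis by simp
  qed
  define I where "I = {m. m < d \<and> K ! m = 0}"
  have I: "i div 2 \<in> I \<longleftrightarrow> i < n \<and> k i = 0" for i by (auto simp: I_def n_def k_def)
  define S where "S i j = poly (p i j) 0" for i j
  have p_const: "poly (p i j) z = S i j" if "i < n" "j < n" "k i + k j = 0" for i j z
  proof -
    have "degree (p i j) = 0" using pd[of i j] that by auto
    then obtain a where "p i j = [:a:]" by (rule degree_eq_zeroE)
    then show ?thesis by (simp add: S_def)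
  qed
  have S_skew: "S j i = - cnj (S i j)" if "i div 2 \<in> I" "j div 2 \<in> I" for i j
    using Bskew[of 1 j i] Bp[of i j 1] Bp[of j i 1] p_const[of i j 1] p_const[of j i 1] that I by simp
  have S_quat: "S i j = qsgn i * qsgn j * cnj (S (qsw i) (qsw j))" if "i div 2 \<in> I" "j div 2 \<in> I" for i j
    using p_tau[of i j 0] that unfolding S_def I by simp
  have "I \<subseteq> {..<d}" by (auto simp: I_def)
  from quaternionic_skew_factor[OF this S_skew S_quat]
  obtain r where r_tau: "\<And>i j. r i j = qsgn i * qsgn j * cnj (r (qsw i) (qsw j))"
    and r: "\<And>i j. i div 2 \<in> I \<Longrightarrow> j div 2 \<in> I \<Longrightarrow>
      S i j = (\<Sum>l<n. if l div 2 \<in> I then r i l * (\<i> * qsgn l) * cnj (r j l) else 0)"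
    unfolding n_def by blast
  (* A block with k i < 0 and k j < 0 of V D4 V^* is the sum of the contributions of V and of its
     adjoint, hence the factor 1/2. *)
  define c :: "nat \<Rightarrow> complex" where "c i = (if k i < 0 then 1 / 2 else 1)" for i
  have cnj_c [simp]: "cnj (c i) = c i" for i by (simp add: c_def)
  define v where "v i l = (if k l > 0 then [:c i:] * p i (bar d l)
    else if k l = 0 then (if k i = 0 then [:r i l:] else 0) else (if i = l then 1 else 0))" for i l
  define V where "V z = mat n n (\<lambda>(i, l). poly (v i l) z)" for z
  have Vc [simp]: "V z \<in> carrier_mat n n" and Vdim [simp]: "dim_row (V z) = n" "dim_col (V z) = n" for z
    by (simp_all add: V_def)
  have V: "V z $$ (i, l) = (if k l > 0 then c i * poly (p i (bar d l)) z
    else if k l = 0 then (if k i = 0 then r i l else 0) else (if i = l then 1 else 0))"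
    if "i < n" "l < n" for i l z using that by (simp add: V_def v_def)
  have "qtau d (V (cnj z)) = V z" for z
  proof (rule eq_matI)
    fix i l assume "i < dim_row (V z)" "l < dim_col (V z)"
    then have il: "i < n" "l < n" using Vc[of z] by auto
    have sw: "qsw i = qsw l \<longleftrightarrow> i = l" by (metis qsw_qsw)
    have "qtau d (V (cnj z)) $$ (i, l) = qsgn i * qsgn l * cnj (V (cnj z) $$ (qsw i, qsw l))"
      using il by (simp add: n_def)
    also have "\<dots> = V z $$ (i, l)"
    proof -
      consider "k l > 0" | "k l = 0" | "k l < 0" by linarith
      then show ?thesis
      proof cases
        case 1
        have "c (qsw i) = c i" by (simp add: c_def)
        then show ?thesis
          using 1 il p_tau[OF il(1) bar_less[OF il(2)], of z]
          by (simp add: V qsw_less bar_qsw qsgn_bar mult_ac)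
      next
        case 2
        then show ?thesis using il r_tau[of i l] by (simp add: V qsw_less)
      next
        case 3
        then show ?thesis using il by (simp add: V qsw_less sw)
      qed
    qed
    finally show "qtau d (V (cnj z)) $$ (i, l) = V z $$ (i, l)" .
  qed (simp_all add: V_def n_def)
  moreover have "mat_poly n V" unfolding mat_poly_def V_def[abs_def] by (intro exI[of _ v] allI refl)
  \<comment> \<open>Since \<open>k (bar d l) = - k l\<close>, the degree of
    \<open>p i (bar d l)\<close> is at most \<open>k l - k i\<close>; so \<open>V\<close> is
    triangular for the weight \<open>- k\<close>.\<close>
  moreover have "det (V z) = det (V w)" for z w
  proof (rule det_weight_triangular_cong[OF Vc Vc, of "\<lambda>i. - k i"])
    fix i j assume ij: "i < n" "j < n" and lt: "- k i < - k j"
    have "p i (bar d j) = 0" using pd[OF ij(1) bar_less[OF ij(2)]] lt k_bar[OF ij(2)] by auto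
    then show "V z $$ (i, j) = 0 \<and> V w $$ (i, j) = 0" using lt ij by (auto simp: V)
  next
    fix i j assume ij: "i < n" "j < n" and eq: "- k i = - k j"
    have "k i + k (bar d j) = 0" using eq k_bar[OF ij(2)] by simp
    from p_const[OF ij(1) bar_less[OF ij(2)] this]
    show "V z $$ (i, j) = V w $$ (i, j)" using ij by (simp add: V)
  qed
  moreover have "B z = V z * D4 d K z * cadj (V z)" if z: "cmod z = 1" for z
  proof (rule eq_matI)
    have z0: "z \<noteq> 0" using z by auto
    have Dc: "D4 d K z \<in> carrier_mat n n" by (simp add: D4_def n_def)
    fix i j assume "i < dim_row (V z * D4 d K z * cadj (V z))" "j < dim_col (V z * D4 d K z * cadj (V z))"
    then have ij: "i < n" "j < n" using Vc[of z] by (auto simp: cadj_def)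
    define b where "b = B z $$ (i, j)"
    \<comment> \<open>\<open>upper\<close> and \<open>lower\<close> are the contributions of
      \<open>W\<close> and of its adjoint to the entry \<open>(i, j)\<close>.\<close>
    have upper: "k j < 0 \<Longrightarrow> V z $$ (i, bar d j) * z powi k j = c i * b"
      using ij bar_less k_bar by (simp add: V b_def Bp z bar_bar mult_ac)
    have lower: "k i < 0 \<Longrightarrow> z powi (- k i) * cnj (V z $$ (j, bar d i)) = - (c j * b)"
    proof -
      assume ki: "k i < 0"
      have "c j * b = - (c j * cnj (z powi k i * poly (p j i) z))"
        unfolding b_def Bskew[OF z ij] Bp[OF ij(2,1) z] by simp
      also have "\<dots> = - (z powi (- k i) * cnj (c j * poly (p j i) z))"
        by (simp add: powi_cnj_circle[OF z])
      finally show ?thesis using ki ij bar_less k_bar by (simp add: V bar_bar)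
    qed
    define t where "t l = (if k l = 0 then l else bar d l)" for l
    have "(V z * D4 d K z * cadj (V z)) $$ (i, j) = (\<Sum>l<n. V z $$ (i, t l) * D4_coeff K z l * cnj (V z $$ (j, l)))"
      unfolding mat_mult_entry[OF mult_carrier_mat[OF Vc Dc] cadj_carrier[OF Vc] ij]
      using ij mult_D4_entry[OF anti Vc[unfolded n_def]]
      by (intro sum.cong refl) (simp add: n_def t_def k_def del: index_mult_mat(1) cadj_entry
          add: cadj_entry[OF Vc[unfolded n_def]])
    \<comment> \<open>For \<open>k l > 0\<close> the left factor is an entry of a unit vector and
      selects \<open>l = bar d i\<close>; for \<open>k l < 0\<close> the right one selects
      \<open>l = j\<close>; \<open>k l = 0\<close> leaves the diagonalized form.\<close>
    also have "\<dots> = (\<Sum>l<n. (if l = bar d i then (if k i < 0 then c j * b else 0) else 0)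
      + (if l = j then (if k j < 0 then c i * b else 0) else 0)
      + (if l div 2 \<in> I then (if k i = 0 \<and> k j = 0 then r i l * (\<i> * qsgn l) * cnj (r j l) else 0) else 0))"
    proof (intro sum.cong refl)
      fix l assume "l \<in> {..<n}"
      then have l: "l < n" by simp
      have lbar: "i = bar d l \<longleftrightarrow> l = bar d i" using bar_bar l ij by metis
      consider "k l > 0" | "k l = 0" | "k l < 0" by linarith
      then show "V z $$ (i, t l) * D4_coeff K z l * cnj (V z $$ (j, l))
        = (if l = bar d i then (if k i < 0 then c j * b else 0) else 0)
          + (if l = j then (if k j < 0 then c i * b else 0) else 0)
          + (if l div 2 \<in> I then (if k i = 0 \<and> k j = 0 then r i l * (\<i> * qsgn l) * cnj (r j l) else 0) else 0)"
      proof cases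
        case 1
        have D: "D4_coeff K z l = - (z powi k l)" using 1 by (simp add: D4_coeff_def k_def)
        have t: "t l = bar d l" using 1 by (simp add: t_def)
        have Vi: "V z $$ (i, bar d l) = (if l = bar d i then 1 else 0)"
          using 1 k_bar[OF l] unfolding V[OF ij(1) bar_less[OF l]] lbar by simp
        show ?thesis
        proof (cases "l = bar d i")
          case True
          then have ki: "k i < 0" "k l = - k i" using 1 k_bar[OF ij(1)] by simp_all
          have "z powi k l * cnj (V z $$ (j, l)) = - (c j * b)"
            using lower[OF ki(1)] by (simp only: ki(2)[symmetric] True[symmetric])
          moreover have "\<not> (l = j \<and> k j < 0)" using 1 by auto
          ultimately show ?thesis using 1 True ki(1) unfolding D t Vi I by auto
        next
          case False
          moreover have "\<not> (l = j \<and> k j < 0)" using 1 by auto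
          ultimately show ?thesis using 1 unfolding D t Vi I by auto
        qed
      next
        case 2
        then show ?thesis
          using l ij k_bar[OF ij(1)] unfolding I by (auto simp: V t_def D4_coeff_def k_def[symmetric])
      next
        case 3
        have D: "D4_coeff K z l = z powi k l" using 3 by (simp add: D4_coeff_def k_def)
        have t: "t l = bar d l" using 3 by (simp add: t_def)
        have Vj: "V z $$ (j, l) = (if l = j then 1 else 0)"
          using 3 unfolding V[OF ij(2) l] by auto
        have ni: "\<not> (l = bar d i \<and> k i < 0)" using 3 k_bar[OF ij(1)] by auto
        show ?thesis
        proof (cases "l = j")
          case True
          then show ?thesis using 3 ni upper unfolding D t Vj I by auto
        next
          case False
          then show ?thesis using 3 ni unfolding D t Vj I by auto
        qed
      qed
    qed
    also have "\<dots> = (if k i < 0 then c j * b else 0) + (if k j < 0 then c i * b else 0)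
      + (if k i = 0 \<and> k j = 0 then S i j else 0)"
    proof -
      have "(\<Sum>l<n. if l div 2 \<in> I then (if k i = 0 \<and> k j = 0 then r i l * (\<i> * qsgn l) * cnj (r j l) else 0) else 0)
        = (if k i = 0 \<and> k j = 0 then S i j else 0)"
      proof (cases "k i = 0 \<and> k j = 0")
        case True
        then have "i div 2 \<in> I" "j div 2 \<in> I" using ij I by auto
        from r[OF this] show ?thesis using True by (simp cong: if_cong)
      next
        case False
        then show ?thesis by (intro trans[OF sum.neutral]) auto
      qed
      then show ?thesis using ij bar_less[OF ij(1)] by (simp add: sum.distrib)
    qed
    also have "\<dots> = b"
    proof -
      \<comment> \<open>If just one index is negative, the single contribution is weighted by
        \<open>c\<close> at the other index, which is 1. In the last case the degree bound is
        negative, so the entry is 0.\<close>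
      consider "k i < 0 \<or> k j < 0" | "k i = 0" "k j = 0" | "k i \<ge> 0" "k j \<ge> 0" "k i + k j > 0" by linarith
      then show ?thesis
      proof cases
        case 1
        then show ?thesis by (auto simp: c_def)
      next
        case 2
        then show ?thesis using p_const[OF ij] by (simp add: b_def Bp[OF ij z])
      next
        case 3
        then have "p i j = 0" using pd[OF ij] by auto
        then have "b = 0" by (simp add: b_def Bp[OF ij z])
        then show ?thesis using 3 by auto
      qed
    qed
    finally show "B z $$ (i, j) = (V z * D4 d K z * cadj (V z)) $$ (i, j)" by (simp add: b_def)
  qed (use Bc[OF z] in \<open>simp_all add: cadj_def\<close>)
  ultimately show ?thesis unfolding n_def by blast
qed

subsection \<open>Laurent polynomials and the main theorem\<close>

lemma evalL_carrier [simp]: "evalL d c z \<in> carrier_mat (2 * d) (2 * d)"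
  by (simp add: evalL_def)

lemma evalL_entry:
  assumes "finite T" "\<And>r. r \<notin> T \<Longrightarrow> c r = 0\<^sub>m (2 * d) (2 * d)" "i < 2 * d" "j < 2 * d"
  shows "evalL d c z $$ (i, j) = (\<Sum>r\<in>T. z powi r * c r $$ (i, j))"
proof -
  have "(\<Sum>r\<in>{r. c r \<noteq> 0\<^sub>m (2*d) (2*d)}. z powi r * c r $$ (i, j)) = (\<Sum>r\<in>T. z powi r * c r $$ (i, j))"
    using assms by (intro sum.mono_neutral_left) auto
  then show ?thesis using assms(3,4) by (simp add: evalL_def)
qed

lemma lpoly_support:
  assumes "lpoly d c"
  shows "\<exists>T. finite T \<and> (\<forall>r. r \<notin> T \<longrightarrow> c r = 0\<^sub>m (2 * d) (2 * d))"
  using assms unfolding lpoly_def by blast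

lemma mat_poly_evalL:
  assumes c: "lpoly d c" and neg: "\<And>r. r < 0 \<Longrightarrow> c r = 0\<^sub>m (2 * d) (2 * d)"
  shows "mat_poly (2 * d) (evalL d c)"
proof -
  let ?T = "{r. c r \<noteq> 0\<^sub>m (2 * d) (2 * d)}"
  have "evalL d c z = mat (2 * d) (2 * d) (\<lambda>(i, j). poly (\<Sum>r\<in>?T. monom (c r $$ (i, j)) (nat r)) z)" for z
    unfolding evalL_def
  proof (intro cong_mat refl, unfold prod.case poly_sum, intro sum.cong refl)
    fix i j r assume "r \<in> ?T"
    then have "0 \<le> r" using neg by (metis (mono_tags) mem_Collect_eq not_le)
    then show "z powi r * c r $$ (i, j) = poly (monom (c r $$ (i, j)) (nat r)) z"
      by (simp add: poly_monom power_int_def)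
  qed
  then show ?thesis
    unfolding mat_poly_def by (intro exI[of _ "\<lambda>i j. \<Sum>r\<in>?T. monom (c r $$ (i, j)) (nat r)"] allI)
qed

lemma lpoly_reflect:
  assumes "lpoly d c"
  shows "lpoly d (\<lambda>r. c (- r))"
proof -
  have "{r. c (- r) \<noteq> 0\<^sub>m (2*d) (2*d)} = uminus ` {r. c r \<noteq> 0\<^sub>m (2*d) (2*d)}"
    by (force simp: image_iff)
  then show ?thesis using assms by (simp add: lpoly_def)
qed

lemma evalL_reflect:
  assumes "lpoly d c"
  shows "evalL d (\<lambda>r. c (- r)) z = evalL d c (inverse z)"
proof (rule eq_matI)
  fix i j assume "i < dim_row (evalL d c (inverse z))" "j < dim_col (evalL d c (inverse z))"
  then have ij: "i < 2 * d" "j < 2 * d" by (auto simp: evalL_def)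
  obtain T where T: "finite T" "\<And>r. r \<notin> T \<Longrightarrow> c r = 0\<^sub>m (2 * d) (2 * d)"
    using lpoly_support[OF assms] by blast
  have "c (- r) = 0\<^sub>m (2 * d) (2 * d)" if "r \<notin> uminus ` T" for r
    using T(2)[of "- r"] that by (force simp: image_iff)
  then have "evalL d (\<lambda>r. c (- r)) z $$ (i, j) = (\<Sum>r\<in>uminus ` T. z powi r * c (- r) $$ (i, j))"
    using T(1) by (intro evalL_entry ij) auto
  also have "\<dots> = (\<Sum>r\<in>T. inverse z powi r * c r $$ (i, j))"
    by (subst sum.reindex) (auto simp: power_int_minus power_int_inverse intro!: sum.cong)
  also have "\<dots> = evalL d c (inverse z) $$ (i, j)" by (rule evalL_entry[OF T ij, symmetric])
  finally show "evalL d (\<lambda>r. c (- r)) z $$ (i, j) = evalL d c (inverse z) $$ (i, j)" .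
qed (auto simp: evalL_def)

text \<open>\<open>0 powi r = 0\<close> also for negative \<open>r\<close>, so evaluation at 0
  always reads the constant coefficient.\<close>

lemma evalL_0:
  assumes "lpoly d c"
  shows "evalL d c 0 = c 0"
proof (rule eq_matI)
  have cc: "c r \<in> carrier_mat (2 * d) (2 * d)" for r using assms by (simp add: lpoly_def)
  then show "dim_row (evalL d c 0) = dim_row (c 0)" "dim_col (evalL d c 0) = dim_col (c 0)"
    using carrier_matD[OF cc[of 0]] by (simp_all add: evalL_def)
  fix i j assume "i < dim_row (c 0)" "j < dim_col (c 0)"
  then have ij: "i < 2 * d" "j < 2 * d" using carrier_matD[OF cc[of 0]] by simp_all
  obtain T where T: "finite T" "\<And>r. r \<notin> T \<Longrightarrow> c r = 0\<^sub>m (2 * d) (2 * d)"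
    using lpoly_support[OF assms] by blast
  have "evalL d c 0 $$ (i, j) = (\<Sum>r\<in>insert 0 T. 0 powi r * c r $$ (i, j))"
    using T by (intro evalL_entry ij) auto
  also have "\<dots> = (\<Sum>r\<in>insert 0 T. if r = 0 then c 0 $$ (i, j) else 0)"
    by (intro sum.cong) auto
  finally show "evalL d c 0 $$ (i, j) = c 0 $$ (i, j)" using T(1) by simp
qed

text \<open>\<open>z powi (- r)\<close> is the conjugate of \<open>z powi r\<close> because
  \<open>cmod z = 1\<close>. Off the circle the two sides differ in general, which is why the final
  identity is proved on the circle and then extended.\<close>

lemma evalL_ldag_circle:
  assumes c: "lpoly d c" and z: "cmod z = 1"
  shows "evalL d (ldag c) z = cadj (evalL d c z)"
proof (rule eq_matI)
  fix i j assume "i < dim_row (cadj (evalL d c z))" "j < dim_col (cadj (evalL d c z))"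
  then have ij: "i < 2 * d" "j < 2 * d" by (auto simp: evalL_def cadj_def)
  have cc: "c r \<in> carrier_mat (2 * d) (2 * d)" for r using c by (simp add: lpoly_def)
  obtain T where T: "finite T" "\<And>r. r \<notin> T \<Longrightarrow> c r = 0\<^sub>m (2 * d) (2 * d)"
    using lpoly_support[OF c] by blast
  have ent: "evalL d c w $$ (i, j) = (\<Sum>r\<in>T. w powi r * c r $$ (i, j))"
    if "i < 2 * d" "j < 2 * d" for i j w using T that by (intro evalL_entry) auto
  have cadj0: "cadj (0\<^sub>m (2 * d) (2 * d)) = 0\<^sub>m (2 * d) (2 * d)" by (rule eq_matI) (auto simp: cadj_def)
  have "ldag c r = 0\<^sub>m (2 * d) (2 * d)" if "r \<notin> uminus ` T" for r
    using T(2)[of "- r"] that cadj0 by (force simp: ldag_def image_iff)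
  then have "evalL d (ldag c) z $$ (i, j) = (\<Sum>r\<in>uminus ` T. z powi r * ldag c r $$ (i, j))"
    using T by (intro evalL_entry ij) auto
  also have "\<dots> = (\<Sum>r\<in>T. z powi (- r) * cnj (c r $$ (j, i)))"
    by (subst sum.reindex) (simp_all add: ldag_def cadj_entry[OF cc ij])
  also have "\<dots> = cnj (\<Sum>r\<in>T. z powi r * c r $$ (j, i))"
    by (simp add: powi_cnj_circle[OF z])
  also have "\<dots> = cadj (evalL d c z) $$ (i, j)"
    by (simp only: ent[OF ij(2,1)] cadj_entry[OF evalL_carrier ij])
  finally show "evalL d (ldag c) z $$ (i, j) = cadj (evalL d c z) $$ (i, j)" .
qed (auto simp: evalL_def cadj_def)

lemma evalL_uminus:
  assumes "lpoly d c"
  shows "evalL d (\<lambda>r. - c r) z = - evalL d c z"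
proof (rule eq_matI)
  fix i j assume "i < dim_row (- evalL d c z)" "j < dim_col (- evalL d c z)"
  then have ij: "i < 2 * d" "j < 2 * d" by (auto simp: evalL_def)
  have cc: "c r \<in> carrier_mat (2 * d) (2 * d)" for r using assms by (simp add: lpoly_def)
  obtain T where T: "finite T" "\<And>r. r \<notin> T \<Longrightarrow> c r = 0\<^sub>m (2 * d) (2 * d)"
    using lpoly_support[OF assms] by blast
  have "- c r = 0\<^sub>m (2 * d) (2 * d)" if "r \<notin> T" for r
    using T(2)[OF that] by (auto intro: eq_matI)
  then have "evalL d (\<lambda>r. - c r) z $$ (i, j) = (\<Sum>r\<in>T. z powi r * (- c r) $$ (i, j))"
    by (intro evalL_entry T(1) ij)
  also have "\<dots> = - (\<Sum>r\<in>T. z powi r * c r $$ (i, j))"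
    using ij carrier_matD[OF cc] by (simp add: sum_negf)
  also have "\<dots> = - evalL d c z $$ (i, j)" by (simp add: evalL_entry[OF T ij])
  finally show "evalL d (\<lambda>r. - c r) z $$ (i, j) = (- evalL d c z) $$ (i, j)"
    using ij by (simp add: evalL_def)
qed (auto simp: evalL_def)

lemma qtau_evalL:
  assumes "quat_lpoly d c"
  shows "qtau d (evalL d c (cnj z)) = evalL d c z"
proof (rule eq_matI)
  fix i j assume "i < dim_row (evalL d c z)" "j < dim_col (evalL d c z)"
  then have ij: "i < 2 * d" "j < 2 * d" by (auto simp: evalL_def)
  have c: "lpoly d c" and q: "qtau d (c r) = c r" for r
    using assms by (auto simp: quat_lpoly_def quat_mat_iff_qtau)
  obtain T where T: "finite T" "\<And>r. r \<notin> T \<Longrightarrow> c r = 0\<^sub>m (2 * d) (2 * d)"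
    using lpoly_support[OF c] by blast
  have ent: "evalL d c w $$ (i, j) = (\<Sum>r\<in>T. w powi r * c r $$ (i, j))"
    if "i < 2 * d" "j < 2 * d" for i j w using T that by (intro evalL_entry) auto
  have "qtau d (evalL d c (cnj z)) $$ (i, j)
      = (\<Sum>r\<in>T. z powi r * (qsgn i * qsgn j * cnj (c r $$ (qsw i, qsw j))))"
    unfolding qtau_entry[OF ij] ent[OF qsw_less[OF ij(1)] qsw_less[OF ij(2)]]
    by (simp add: sum_distrib_left mult_ac)
  also have "\<dots> = (\<Sum>r\<in>T. z powi r * c r $$ (i, j))"
    using ij by (intro sum.cong refl) (metis q qtau_entry)
  also have "\<dots> = evalL d c z $$ (i, j)" by (rule evalL_entry[OF T ij, symmetric])
  finally show "qtau d (evalL d c (cnj z)) $$ (i, j) = evalL d c z $$ (i, j)" .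
qed (auto simp: evalL_def)

text \<open>Polynomials that agree on the circle have equal coefficients, so the symmetry of
  \<open>W\<close> there passes to each coefficient.\<close>

lemma mat_poly_coefficients:
  assumes W: "mat_poly (2 * d) W" and quat: "\<And>z. cmod z = 1 \<Longrightarrow> qtau d (W (cnj z)) = W z"
  shows "\<exists>c. quat_lpoly d c \<and> (\<forall>r<0. c r = 0\<^sub>m (2 * d) (2 * d)) \<and> (\<forall>z. evalL d c z = W z)"
proof -
  define n where "n = 2 * d"
  obtain p where p: "\<forall>z. W z = mat n n (\<lambda>(i, j). poly (p i j) z)"
    using W unfolding mat_poly_def n_def ..
  define c where "c r = (if r < 0 then 0\<^sub>m n n else mat n n (\<lambda>(i, j). coeff (p i j) (nat r)))" for r :: int
  have cc: "c r \<in> carrier_mat n n" for r by (simp add: c_def)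
  define N where "N = (\<Sum>i<n. \<Sum>j<n. degree (p i j))"
  have N: "degree (p i j) \<le> N" if "i < n" "j < n" for i j
  proof -
    have "degree (p i j) \<le> (\<Sum>j<n. degree (p i j))"
      using that(2) by (intro member_le_sum) auto
    also have "\<dots> \<le> N" unfolding N_def
      using that(1) by (intro member_le_sum[of i "{..<n}" "\<lambda>i. \<Sum>j<n. degree (p i j)"]) auto
    finally show ?thesis .
  qed
  have supp: "c r = 0\<^sub>m n n" if "r \<notin> int ` {..N}" for r
  proof (cases "r < 0")
    case False
    have "N < nat r"
    proof (rule ccontr)
      assume "\<not> N < nat r"
      then have "r = int (nat r)" "nat r \<in> {..N}" using False by auto
      then show False using that by blast
    qed
    then have "coeff (p i j) (nat r) = 0" if "i < n" "j < n" for i j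
      using N[OF that] by (intro coeff_eq_0) simp
    then show ?thesis using False unfolding c_def by (auto intro!: eq_matI)
  qed (simp add: c_def)
  have sub: "{r. c r \<noteq> 0\<^sub>m n n} \<subseteq> int ` {..N}" using supp by blast
  have lp: "lpoly d c"
    unfolding lpoly_def n_def[symmetric] using cc finite_subset[OF sub] by blast
  have "qtau d (c r) = c r" for r
  proof (rule eq_matI)
    fix i j assume "i < dim_row (c r)" "j < dim_col (c r)"
    then have ij: "i < n" "j < n" using cc[of r] by auto
    then have sw: "qsw i < n" "qsw j < n" using qsw_less by (auto simp: n_def)
    have "p i j = [:qsgn i * qsgn j:] * map_poly cnj (p (qsw i) (qsw j))"
    proof (rule poly_eq_on_circle)
      fix z :: complex assume z: "cmod z = 1"
      have "qtau d (W (cnj z)) $$ (i, j) = W z $$ (i, j)" by (simp add: quat[OF z])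
      then show "poly (p i j) z = poly ([:qsgn i * qsgn j:] * map_poly cnj (p (qsw i) (qsw j))) z"
        using ij sw by (simp add: p n_def)
    qed
    then have "coeff (p i j) (nat r) = qsgn i * qsgn j * cnj (coeff (p (qsw i) (qsw j)) (nat r))"
      by (metis coeff_map_poly coeff_smult complex_cnj_zero mult_pCons_left mult_zero_left add_0_right pCons_0_0)
    then show "qtau d (c r) $$ (i, j) = c r $$ (i, j)"
      using ij sw by (simp add: c_def n_def)
  qed (use carrier_matD[OF cc[of r]] in \<open>simp_all add: n_def\<close>)
  then have qm: "quat_mat d (c r)" for r
    unfolding quat_mat_iff_qtau n_def[symmetric] using cc by blast
  have ev: "evalL d c z = W z" for z
  proof (rule eq_matI)
    fix i j assume "i < dim_row (W z)" "j < dim_col (W z)"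
    then have ij: "i < n" "j < n" by (auto simp: p)
    have "evalL d c z $$ (i, j) = (\<Sum>r\<in>int ` {..N}. z powi r * c r $$ (i, j))"
      using supp ij unfolding n_def by (intro evalL_entry) auto
    also have "\<dots> = (\<Sum>k\<le>N. z ^ k * coeff (p i j) k)"
      using ij by (subst sum.reindex) (auto simp: c_def)
    also have "\<dots> = (\<Sum>k\<le>degree (p i j). z ^ k * coeff (p i j) k)"
      using N[OF ij] by (intro sum.mono_neutral_right) (auto simp: coeff_eq_0)
    also have "\<dots> = W z $$ (i, j)"
      using ij by (simp add: p poly_altdef mult.commute)
    finally show "evalL d c z $$ (i, j) = W z $$ (i, j)" .
  qed (auto simp: p evalL_def n_def)
  have "\<forall>r<0. c r = 0\<^sub>m n n" by (simp add: c_def)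
  then show ?thesis using lp qm ev unfolding quat_lpoly_def n_def by blast
qed

section \<open>Identity theorem for Laurent polynomials on the punctured plane\<close>

definition laurent_fun :: "(complex \<Rightarrow> complex) \<Rightarrow> bool" where
  "laurent_fun f \<longleftrightarrow> (\<exists>m p. \<forall>z. z \<noteq> 0 \<longrightarrow> z ^ m * f z = poly p z)"

lemma laurent_fun_const: "laurent_fun (\<lambda>_. c)"
  unfolding laurent_fun_def by (intro exI[of _ 0] exI[of _ "[:c:]"]) simp

lemma laurent_fun_powi: "laurent_fun (\<lambda>z. z powi k)"
  unfolding laurent_fun_def
proof (intro exI allI impI)
  fix z :: complex assume "z \<noteq> 0"
  then show "z ^ nat (- k) * z powi k = poly (monom 1 (nat k)) z"
    by (cases "k \<ge> 0") (auto simp: poly_monom power_int_def power_inverse field_simps)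
qed

lemma laurent_fun_add:
  assumes "laurent_fun f" "laurent_fun g"
  shows "laurent_fun (\<lambda>z. f z + g z)"
proof -
  obtain m p where p: "\<forall>z. z \<noteq> 0 \<longrightarrow> z ^ m * f z = poly p z"
    using assms(1) unfolding laurent_fun_def by blast
  obtain l q where q: "\<forall>z. z \<noteq> 0 \<longrightarrow> z ^ l * g z = poly q z"
    using assms(2) unfolding laurent_fun_def by blast
  have "z ^ (m + l) * (f z + g z) = poly (monom 1 l * p + monom 1 m * q) z" if "z \<noteq> 0" for z
  proof -
    have "z ^ (m + l) * (f z + g z) = z ^ l * (z ^ m * f z) + z ^ m * (z ^ l * g z)"
      by (simp add: power_add algebra_simps)
    then show ?thesis using p q that by (simp add: poly_monom)
  qed
  then show ?thesis unfolding laurent_fun_def by blast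
qed

lemma laurent_fun_mult:
  assumes "laurent_fun f" "laurent_fun g"
  shows "laurent_fun (\<lambda>z. f z * g z)"
proof -
  obtain m p where p: "\<forall>z. z \<noteq> 0 \<longrightarrow> z ^ m * f z = poly p z"
    using assms(1) unfolding laurent_fun_def by blast
  obtain l q where q: "\<forall>z. z \<noteq> 0 \<longrightarrow> z ^ l * g z = poly q z"
    using assms(2) unfolding laurent_fun_def by blast
  have "z ^ (m + l) * (f z * g z) = poly (p * q) z" if "z \<noteq> 0" for z
  proof -
    have "z ^ (m + l) * (f z * g z) = (z ^ m * f z) * (z ^ l * g z)"
      by (simp add: power_add mult_ac)
    then show ?thesis using p q that by simp
  qed
  then show ?thesis unfolding laurent_fun_def by blast
qed

lemma laurent_fun_sum:
  "(\<And>i. i \<in> I \<Longrightarrow> laurent_fun (f i)) \<Longrightarrow> laurent_fun (\<lambda>z. \<Sum>i\<in>I. f i z)"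
  by (induction I rule: infinite_finite_induct) (auto intro: laurent_fun_add laurent_fun_const)

text \<open>A power of \<open>z\<close> clears the poles at 0, and the resulting polynomial has
  infinitely many zeros.\<close>

lemma laurent_fun_eqI:
  assumes "laurent_fun f" "laurent_fun g" and eq: "\<And>z. cmod z = 1 \<Longrightarrow> f z = g z" and z: "z \<noteq> 0"
  shows "f z = g z"
proof -
  have "laurent_fun (\<lambda>z. f z + (- 1) * g z)"
    by (intro laurent_fun_add laurent_fun_mult laurent_fun_const assms)
  then obtain m p where p: "\<forall>z. z \<noteq> 0 \<longrightarrow> z ^ m * (f z + (- 1) * g z) = poly p z"
    unfolding laurent_fun_def by blast
  have "p = 0"
  proof (rule poly_eq_on_circle)
    fix w :: complex assume w: "cmod w = 1"
    then have "w \<noteq> 0" by auto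
    with p have "w ^ m * (f w + (- 1) * g w) = poly p w" by blast
    then show "poly p w = poly 0 w" using eq[OF w] by simp
  qed
  then have "z ^ m * (f z + (- 1) * g z) = 0" using p z by simp
  then show ?thesis using z by simp
qed

definition mat_laurent :: "nat \<Rightarrow> (complex \<Rightarrow> complex mat) \<Rightarrow> bool" where
  "mat_laurent n F \<longleftrightarrow> (\<forall>z. F z \<in> carrier_mat n n) \<and>
     (\<forall>i<n. \<forall>j<n. laurent_fun (\<lambda>z. F z $$ (i, j)))"

lemma mat_laurent_mult:
  assumes F: "mat_laurent n F" and G: "mat_laurent n G"
  shows "mat_laurent n (\<lambda>z. F z * G z)"
proof -
  have Fc: "F z \<in> carrier_mat n n" and Gc: "G z \<in> carrier_mat n n" for z
    using F G by (auto simp: mat_laurent_def)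
  have "laurent_fun (\<lambda>z. (F z * G z) $$ (i, j))" if ij: "i < n" "j < n" for i j
  proof -
    have "laurent_fun (\<lambda>z. \<Sum>l<n. F z $$ (i, l) * G z $$ (l, j))"
      using F G ij by (intro laurent_fun_sum laurent_fun_mult) (auto simp: mat_laurent_def)
    then show ?thesis unfolding mat_mult_entry[OF Fc Gc ij] .
  qed
  then show ?thesis unfolding mat_laurent_def using mult_carrier_mat[OF Fc Gc] by blast
qed

lemma mat_laurent_evalL: "mat_laurent (2 * d) (evalL d c)"
  unfolding mat_laurent_def
proof (intro conjI allI impI evalL_carrier)
  fix i j assume "i < 2 * d" "j < 2 * d"
  then show "laurent_fun (\<lambda>z. evalL d c z $$ (i, j))"
    by (simp add: evalL_def laurent_fun_sum laurent_fun_mult laurent_fun_const laurent_fun_powi)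
qed

lemma mat_laurent_D4: "mat_laurent (2 * d) (D4 d K)"
proof -
  have "laurent_fun (\<lambda>z. - 1 * (\<Sum>m\<in>{m. m < d \<and> K ! m > 0}.
      z powi (K ! m) * blk_entry (1\<^sub>m 2) (d - 1 - m) m i j
      + - 1 * (z powi (- (K ! m)) * blk_entry (1\<^sub>m 2) m (d - 1 - m) i j))
    + (\<Sum>m\<in>{m. m < d \<and> K ! m = 0}. blk_entry qk m m i j))" for i j
    by (intro laurent_fun_add laurent_fun_mult laurent_fun_sum laurent_fun_const laurent_fun_powi)
  then show ?thesis unfolding mat_laurent_def by (simp add: D4_def)
qed

lemma mat_laurent_eqI:
  assumes F: "mat_laurent n F" and G: "mat_laurent n G"
    and eq: "\<And>z. cmod z = 1 \<Longrightarrow> F z = G z" and z: "z \<noteq> 0"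
  shows "F z = G z"
proof (rule eq_matI)
  have Fc: "F z \<in> carrier_mat n n" and Gc: "G z \<in> carrier_mat n n"
    using F G by (auto simp: mat_laurent_def)
  then show "dim_row (F z) = dim_row (G z)" "dim_col (F z) = dim_col (G z)" by auto
  fix i j assume "i < dim_row (G z)" "j < dim_col (G z)"
  then have ij: "i < n" "j < n" using Gc by auto
  have "laurent_fun (\<lambda>z. F z $$ (i, j))" "laurent_fun (\<lambda>z. G z $$ (i, j))"
    using F G ij by (auto simp: mat_laurent_def)
  then show "F z $$ (i, j) = G z $$ (i, j)"
    by (rule laurent_fun_eqI[OF _ _ _ z]) (simp only: eq)
qed

lemma qtau_mat_inv:
  assumes X: "X \<in> carrier_mat (2 * d) (2 * d)" and det: "det X \<noteq> 0"
  shows "qtau d (mat_inv X) = mat_inv (qtau d X)"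
proof -
  have 1: "qtau d X * qtau d (mat_inv X) = 1\<^sub>m (2 * d)"
    using mat_inv(1)[OF X det] X by (simp flip: qtau_mult)
  then have "det (qtau d X) \<noteq> 0" by (intro det_nonzero_if_mult_one(1)[of _ "2 * d"]) auto
  then have "mat_inv (qtau d X) * (qtau d X * qtau d (mat_inv X)) = qtau d (mat_inv X)"
    by (intro mat_eq_mult_cancel[of _ "2 * d"] mat_inv(2)) auto
  then show ?thesis unfolding 1 by (simp add: right_mult_one_mat[of _ "2 * d" "2 * d"])
qed

lemma qtau_congruence_core:
  assumes Q: "Q \<in> carrier_mat (2 * d) (2 * d)" and A: "A \<in> carrier_mat (2 * d) (2 * d)"
    and det: "det Q \<noteq> 0"
  shows "qtau d (congruence_core Q A) = congruence_core (qtau d Q) (qtau d A)"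
  unfolding congruence_core_def using Q A
  by (simp add: qtau_mult mult_carrier_mat[of _ "2 * d" "2 * d"] qtau_cadj qtau_mat_inv[OF Q det])

lemma mat_poly_const:
  assumes "A \<in> carrier_mat n n"
  shows "mat_poly n (\<lambda>_. A)"
  unfolding mat_poly_def
proof (intro exI[of _ "\<lambda>i j. [:A $$ (i, j):]"] allI eq_matI)
qed (use assms in auto)

definition bar_mat :: "nat \<Rightarrow> complex mat" where
  "bar_mat d = mat (2 * d) (2 * d) (\<lambda>(i, j). if i = bar d j then 1 else 0)"

lemma bar_mat_carrier [simp]: "bar_mat d \<in> carrier_mat (2 * d) (2 * d)"
  by (simp add: bar_mat_def)

lemma bar_mat_mult_entry:
  assumes A: "A \<in> carrier_mat (2 * d) (2 * d)" and ij: "i < 2 * d" "j < 2 * d"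
  shows "(bar_mat d * A) $$ (i, j) = A $$ (bar d i, j)"
proof -
  have "(bar_mat d * A) $$ (i, j) = (\<Sum>l<2*d. if l = bar d i then A $$ (bar d i, j) else 0)"
    unfolding mat_mult_entry[OF bar_mat_carrier A ij]
  proof (intro sum.cong refl)
    fix l assume "l \<in> {..<2 * d}"
    then have l: "l < 2 * d" by simp
    have "i = bar d l \<longleftrightarrow> l = bar d i" using bar_bar[OF l] bar_bar[OF ij(1)] by metis
    then show "bar_mat d $$ (i, l) * A $$ (l, j) = (if l = bar d i then A $$ (bar d i, j) else 0)"
      using l ij by (simp add: bar_mat_def)
  qed
  then show ?thesis using bar_less[OF ij(1)] by simp
qed

lemma bar_mat_square: "bar_mat d * bar_mat d = 1\<^sub>m (2 * d)"
proof (rule eq_matI)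
  fix i j assume "i < dim_row (1\<^sub>m (2 * d) :: complex mat)" "j < dim_col (1\<^sub>m (2 * d) :: complex mat)"
  then have ij: "i < 2 * d" "j < 2 * d" by auto
  have "bar d i = bar d j \<longleftrightarrow> i = j" using bar_bar[OF ij(1)] bar_bar[OF ij(2)] by metis
  then show "(bar_mat d * bar_mat d) $$ (i, j) = 1\<^sub>m (2 * d) $$ (i, j)"
    unfolding bar_mat_mult_entry[OF bar_mat_carrier ij]
    using ij bar_less[OF ij(1)] by (simp add: bar_mat_def)
qed (simp_all add: bar_mat_def)

text \<open>Column \<open>j\<close> of the core carries \<open>z powi (- e j)\<close>, whereas
  \<open>D4\<close> has exponent \<open>K ! (j div 2)\<close> there. So the exponents must be
  arranged as \<open>- K\<close>, and the block reversal turns the sorted arrangement into this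
  one.\<close>

lemma bar_mat_diag_pow:
  assumes "\<And>i. i < 2 * d \<Longrightarrow> e (bar d i) = - e i"
  shows "bar_mat d * diag_pow (2 * d) e z = diag_pow (2 * d) (\<lambda>i. - e i) z * bar_mat d"
proof (rule eq_matI)
  fix i j assume "i < dim_row (diag_pow (2 * d) (\<lambda>i. - e i) z * bar_mat d)"
    "j < dim_col (diag_pow (2 * d) (\<lambda>i. - e i) z * bar_mat d)"
  then have ij: "i < 2 * d" "j < 2 * d" by (auto simp: bar_mat_def diag_pow_def)
  show "(bar_mat d * diag_pow (2 * d) e z) $$ (i, j)
      = (diag_pow (2 * d) (\<lambda>i. - e i) z * bar_mat d) $$ (i, j)"
    unfolding diag_pow_mult_entry[OF bar_mat_carrier ij]
    using ij assms[OF ij(2)] by (simp add: bar_mat_def)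
qed (simp_all add: bar_mat_def diag_pow_def)

theorem theorem3p4:
  fixes d :: nat and A :: "int \<Rightarrow> complex mat" and K :: "int list"
  assumes "quat_lpoly d A"
    and "\<forall>r. ldag A r = - A r"
    and "\<forall>z. cmod z = 1 \<longrightarrow> det (evalL d A z) \<noteq> 0"
    and "sym_partial_indices d A K"
  shows "\<exists>Ap. quat_lpoly d Ap \<and> (\<forall>r<0. Ap r = 0\<^sub>m (2*d) (2*d)) \<and>
           (\<forall>z. cmod z \<le> 1 \<longrightarrow> det (evalL d Ap z) \<noteq> 0) \<and>
           (\<forall>z. z \<noteq> 0 \<longrightarrow> evalL d A z = evalL d Ap z * D4 d K z * evalL d (ldag Ap) z)"
proof -
  let ?n = "2 * d"
  note assoc = assoc_mult_mat[of _ ?n ?n _ ?n _ ?n]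
  have mc [simp]: "X * Y \<in> carrier_mat ?n ?n" if "X \<in> carrier_mat ?n ?n" "Y \<in> carrier_mat ?n ?n"
    for X Y :: "complex mat" using that by simp
  define F where "F = evalL d A"
  have Fc [simp]: "F z \<in> carrier_mat ?n ?n" for z by (simp add: F_def)
  have lpA: "lpoly d A" using assms(1) by (simp add: quat_lpoly_def)
  have F_tau: "qtau d (F (cnj z)) = F z" for z unfolding F_def by (rule qtau_evalL[OF assms(1)])
  have F_skew: "cadj (F z) = - F z" if "cmod z = 1" for z
  proof -
    have "ldag A = (\<lambda>r. - A r)" using assms(2) by auto
    then show ?thesis
      using evalL_ldag_circle[OF lpA that] evalL_uminus[OF lpA, of z] unfolding F_def by metis
  qed
  define k where "k i = K ! (i div 2)" for i
  have len: "length K = d" and sorted: "sorted_wrt (\<ge>) K"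
    using assms(4) by (auto simp: sym_partial_indices_def)
  obtain Ap Am where WH: "std_WH d A Ap (map (\<lambda>i. K ! (i div 2)) [0..<?n]) Am"
    using assms(4) unfolding sym_partial_indices_def std_partial_indices_def by blast
  define P where "P = evalL d Ap"
  define N where "N = evalL d (\<lambda>r. Am (- r))"
  have Pc [simp]: "P z \<in> carrier_mat ?n ?n" and Nc [simp]: "N z \<in> carrier_mat ?n ?n" for z
    by (simp_all add: P_def N_def)
  have P: "mat_poly ?n P"
    using WH unfolding std_WH_def P_def by (auto intro: mat_poly_evalL)
  have detP: "det (P z) \<noteq> 0" if "cmod z \<le> 1" for z
    using WH that unfolding std_WH_def P_def by auto
  have lpAm: "lpoly d Am" and Am_pos: "\<And>r. r > 0 \<Longrightarrow> Am r = 0\<^sub>m ?n ?n"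
    using WH by (auto simp: std_WH_def)
  have N: "mat_poly ?n N" unfolding N_def
    by (intro mat_poly_evalL lpoly_reflect lpAm) (simp add: Am_pos)
  have N_inv: "N z = evalL d Am (inverse z)" for z unfolding N_def by (rule evalL_reflect[OF lpAm])
  have detN: "det (N z) \<noteq> 0" if z: "cmod z \<le> 1" for z
  proof (cases "z = 0")
    case True
    \<comment> \<open>\<open>N 0\<close> is the value of the minus factor at infinity, covered by
      the condition on \<open>Am 0\<close>.\<close>
    have "N 0 = Am 0" unfolding N_def by (simp add: evalL_0 lpoly_reflect lpAm)
    then show ?thesis using WH True by (simp add: std_WH_def)
  next
    case False
    then have "cmod (inverse z) \<ge> 1" using z by (simp add: norm_inverse one_le_inverse)
    then show ?thesis using WH False unfolding N_inv std_WH_def by auto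
  qed
  have F_WH: "F z = P z * diag_pow ?n k z * N (cnj z)" if z: "cmod z = 1" for z
  proof -
    have "z \<noteq> 0" using z by auto
    moreover have "diag_powi ?n (map (\<lambda>i. K ! (i div 2)) [0..<?n]) z = diag_pow ?n k z"
      unfolding diag_powi_def diag_pow_def k_def by (intro cong_mat) auto
    moreover have "inverse (cnj z) = z"
      using z complex_norm_square[of z] by (intro inverse_unique) (simp add: mult.commute)
    ultimately show ?thesis using WH unfolding F_def P_def N_inv std_WH_def by metis
  qed
  \<comment> \<open>The pairing is drawn from the factors \<open>P\<close> and \<open>N\<close>
    before any quaternionic correction, because the reordering that precedes this correction relies
    on it.\<close>
  obtain \<pi> where \<pi>: "\<pi> permutes {0..<?n}" "\<And>i. i < ?n \<Longrightarrow> k (\<pi> i) = - k i"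
    using skew_index_pairing[OF mat_poly_rational[OF P] detP mat_poly_rational[OF N] detN F_WH F_skew]
    by auto
  have anti: "K ! (d - 1 - m) = - K ! m" if "m < d" for m
    using sorted_index_antisymmetric[OF len sorted \<pi>(1) _ that] \<pi>(2) unfolding k_def by blast
  have k_bar: "k (bar d i) = - k i" if "i < ?n" for i
    using anti[of "i div 2"] that by (simp add: k_def bar_div_2[OF that])
  (* Conjugating by the block reversal replaces D by its inverse, the order that suits D4. *)
  define e where "e i = - k i" for i
  have e_bar: "e (bar d i) = - e i" if "i < ?n" for i using k_bar[OF that] by (simp add: e_def)
  have e_qsw: "e (qsw i) = e i" for i by (simp add: e_def k_def)
  have det_bar: "det (bar_mat d) \<noteq> 0"
    using det_nonzero_if_mult_one(1)[OF _ _ bar_mat_square] by simp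
  define P' where "P' z = P z * bar_mat d" for z
  define N' where "N' z = bar_mat d * N z" for z
  have P': "mat_poly ?n P'" unfolding P'_def[abs_def]
    by (intro mat_poly_mult P mat_poly_const) simp
  have N': "mat_rational ?n N'" unfolding N'_def[abs_def]
    by (intro mat_poly_rational mat_poly_mult N mat_poly_const) simp
  have detP': "det (P' z) \<noteq> 0" and detN': "det (N' z) \<noteq> 0" if "cmod z \<le> 1" for z
    using detP[OF that] detN[OF that] det_bar by (simp_all add: P'_def N'_def det_mult[of _ ?n])
  have F_WH': "F z = P' z * diag_pow ?n e z * N' (cnj z)" if z: "cmod z = 1" for z
  proof -
    have "diag_pow ?n (\<lambda>i. - e i) z * bar_mat d = bar_mat d * diag_pow ?n e z"
      by (rule bar_mat_diag_pow[symmetric]) (rule e_bar)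
    then have "bar_mat d * diag_pow ?n e z * bar_mat d = diag_pow ?n k z * (bar_mat d * bar_mat d)"
      by (simp add: e_def flip: assoc)
    also have "\<dots> = diag_pow ?n k z"
      unfolding bar_mat_square by (simp add: right_mult_one_mat[of _ ?n ?n])
    finally have "P z * (bar_mat d * diag_pow ?n e z * bar_mat d) * N (cnj z) = F z"
      by (simp add: F_WH[OF z])
    then show ?thesis by (simp add: P'_def N'_def assoc)
  qed
  obtain Q M where Q: "mat_poly ?n Q" and detQ: "\<And>z. cmod z \<le> 1 \<Longrightarrow> det (Q z) \<noteq> 0"
    and M: "mat_rational ?n M" and detM: "\<And>z. cmod z \<le> 1 \<Longrightarrow> det (M z) \<noteq> 0"
    and F_QM: "\<And>z. cmod z = 1 \<Longrightarrow> F z = Q z * diag_pow ?n e z * M (cnj z)"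
    and Q_tau: "\<And>z. cmod z \<le> 1 \<Longrightarrow> qtau d (Q (cnj z)) = Q z"
    using quaternionic_left_factor[OF P' detP' N' detN' e_qsw F_WH' F_tau] by blast
  have Qc [simp]: "Q z \<in> carrier_mat ?n ?n" for z
    using mat_rational_carrier[OF mat_poly_rational[OF Q]] .
  obtain p where p: "\<And>i j z. i < ?n \<Longrightarrow> j < ?n \<Longrightarrow> cmod z = 1 \<Longrightarrow>
      congruence_core (Q z) (F z) $$ (i, j) = z powi (- e j) * poly (p i j) z"
    and pd: "\<And>i j. i < ?n \<Longrightarrow> j < ?n \<Longrightarrow> p i j = 0 \<or> int (degree (p i j)) \<le> e i + e j"
    using congruence_core_laurent[OF mat_poly_rational[OF Q] detQ M F_QM F_skew] by metis
  define B where "B z = congruence_core (Q z) (F z)" for z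
  have "\<exists>V. mat_poly ?n V \<and> (\<forall>z. qtau d (V (cnj z)) = V z) \<and> (\<forall>z w. det (V z) = det (V w)) \<and>
    (\<forall>z. cmod z = 1 \<longrightarrow> B z = V z * D4 d K z * cadj (V z))"
  proof (rule skew_laurent_normal_form[OF anti])
    fix z :: complex assume z: "cmod z = 1"
    show "B z \<in> carrier_mat ?n ?n" by (simp add: B_def)
    show "cadj (B z) = - B z"
      unfolding B_def using z by (intro congruence_core(2)[of _ ?n] Fc Qc detQ F_skew) auto
    have "qtau d (B (cnj z)) = congruence_core (qtau d (Q (cnj z))) (qtau d (F (cnj z)))"
      unfolding B_def using z detQ[of "cnj z"] by (intro qtau_congruence_core) auto
    then show "qtau d (B (cnj z)) = B z" using z by (simp add: Q_tau F_tau B_def)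
  next
    fix i j z assume "i < ?n" "j < ?n" "cmod z = 1"
    then show "B z $$ (i, j) = z powi (K ! (j div 2)) * poly (p i j) z"
      using p by (simp add: B_def e_def k_def)
  next
    fix i j assume "i < ?n" "j < ?n"
    then show "p i j = 0 \<or> int (degree (p i j)) \<le> - (K ! (i div 2) + K ! (j div 2))"
      using pd[of i j] by (simp add: e_def k_def)
  qed
  then obtain V where V: "mat_poly ?n V" and V_tau: "\<And>z. qtau d (V (cnj z)) = V z"
    and detV: "\<And>z w. det (V z) = det (V w)"
    and BV: "\<And>z. cmod z = 1 \<Longrightarrow> B z = V z * D4 d K z * cadj (V z)" by blast
  have Vc [simp]: "V z \<in> carrier_mat ?n ?n" for z
    using mat_rational_carrier[OF mat_poly_rational[OF V]] .
  have Dc [simp]: "D4 d K z \<in> carrier_mat ?n ?n" for z by (simp add: D4_def)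
  have detV0: "det (V z) \<noteq> 0" for z
  proof -
    \<comment> \<open>The normal form yields only that \<open>det V\<close> is constant; it is
      nonzero because it divides the determinant of the invertible core at 1.\<close>
    have "det (B 1) \<noteq> 0" unfolding B_def
      using detQ[of 1] assms(3) by (intro congruence_core(3)[of _ ?n] Qc Fc) (auto simp: F_def)
    then have "det (V 1) \<noteq> 0" using BV[of 1] by (auto simp: det_mult[of _ ?n])
    then show ?thesis using detV[of z 1] by simp
  qed
  define W where "W z = Q z * V z" for z
  have Wc [simp]: "W z \<in> carrier_mat ?n ?n" for z by (simp add: W_def)
  have W: "mat_poly ?n W" unfolding W_def[abs_def] by (intro mat_poly_mult Q V)
  have "qtau d (W (cnj z)) = W z" if "cmod z = 1" for z
    using that by (simp add: W_def qtau_mult Q_tau V_tau)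
  then obtain C where C: "quat_lpoly d C" "\<forall>r<0. C r = 0\<^sub>m ?n ?n" and CW: "\<And>z. evalL d C z = W z"
    using mat_poly_coefficients[OF W] by blast
  have lpC: "lpoly d C" using C(1) by (simp add: quat_lpoly_def)
  have "det (evalL d C z) \<noteq> 0" if "cmod z \<le> 1" for z
    unfolding CW W_def using detQ[OF that] detV0 by (simp add: det_mult[of _ ?n])
  moreover have "evalL d A z = evalL d C z * D4 d K z * evalL d (ldag C) z" if "z \<noteq> 0" for z
  proof (rule mat_laurent_eqI[OF _ _ _ that])
    show "mat_laurent ?n (evalL d A)" by (rule mat_laurent_evalL)
    show "mat_laurent ?n (\<lambda>z. evalL d C z * D4 d K z * evalL d (ldag C) z)"
      by (intro mat_laurent_mult mat_laurent_evalL mat_laurent_D4)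
    fix z :: complex assume z: "cmod z = 1"
    have "F z = Q z * B z * cadj (Q z)"
      unfolding B_def using z by (intro congruence_core(1)[of _ ?n] Fc Qc detQ) auto
    also have "\<dots> = W z * D4 d K z * cadj (W z)"
      by (simp add: BV[OF z] W_def cadj_mult[of _ ?n] assoc)
    finally show "evalL d A z = evalL d C z * D4 d K z * evalL d (ldag C) z"
      by (simp add: F_def evalL_ldag_circle[OF lpC z] CW)
  qed
  ultimately show ?thesis using C by blast
qed

end
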